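(* Let $N\ge1$, $T>0$, $Q_T=\mathbb{R}^N\times(0,T]$, $\bar Q_T=\mathbb{R}^N\times[0,T]$, $\sigma\in(0,1]$. Let $K^\sigma:\mathbb{R}^N\to\mathbb{R}$ be nonnegative and measurable and such that $\bar k(z):=K^\sigma(z)|z|^{N+\sigma}$ is bounded on $\mathbb{R}^N$, continuous at the origin, with $\bar k(0)>0$. Let $F\in C(\mathbb{R}^N\times\mathbb{R}^N\times\mathbb{R})$ satisfy: (1) there are $n>0$, $m>1$ and a modulus of continuity $\omega$ such that for all $x_i,p_i\in\mathbb{R}^N$, $l_i\in\mathbb{R}$, $i=1,2$, $$|F(x_1,p_1,l_1)-F(x_2,p_2,l_2)|\le\omega\Big(|l_1-l_2|+|x_1-x_2|(1+|l|+|p|^m)^n+|p_1-p_2|(1+|l|+|p|^m)^n\Big),$$ where $|p|=\max\{|p_1|,|p_2|\}$, $|l|=\max\{|l_1|,|l_2|\}$; (2) (degenerate ellipticity in the nonlocal variable) $F(x,p,l_1)\le F(x,p,l_2)$ for all $x,p\in\mathbb{R}^N$ and $l_1\ge l_2$; (3) (superlinearity in the gradient) there exist $m'>1$ and $C,c>0$ such that $F(x,p,l)\ge c|p|^{m'}-C(|l|+1)$ for all $x,p\in\mathbb{R}^N$, $l\in\mathbb{R}$. Let $u_0$ be bounded and uniformly continuous on $\mathbb{R}^N$. Let $\underline u$ be a bounded lower semicontinuous viscosity supersolution and $\bar u$ a bounded upper semicontinuous viscosity subsolution in $Q_T$ of the Cauchy problem $$u_t+F(x,Du,\mathcal{I}(u,x))=0\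 \text{ in }Q_T,\qquad u(x,0)=u_0(x),\ x\in\mathbb{R}^N,$$ both attaining uniformly continuously the initial data $u_0$, i.e. there is a modulus of continuity $\omega_0$ such that, for $u=\underline u$ and $u=\bar u$, $$\sup_{x\in\mathbb{R}^N}|u(x,t)-u_0(x)|\le\omega_0(t),\quad t\in[0,T].$$ Then $\bar u\le\underline u$ in $\bar Q_T$. In particular, there exists at most one viscosity solution of the Cauchy problem among functions that attain uniformly continuously the initial data $u_0$ (in the sense just described, for some modulus).
   Context: A modulus of continuity is a nondecreasing function $\omega:[0,\infty)\to[0,\infty)$ with $\omega(t)\to\omega(0)=0$ as $t\to0^+$. $B_\delta$ is the ball of radius $\delta$ centered at $0$, $B_\delta(x)$ the ball centered at $x$, $B=B_1$. Set $\mathbb{I}_\sigma=1$ if $\sigma=1$ and $\mathbb{I}_\sigma=0$ if $\sigma<1$. The nonlocal operator, acting in the space variable at fixed time, is $$\mathcal{I}(u,x)=\int_{\mathbb{R}^N}[u(x+z)-u(x)-\mathbb{I}_\sigma\mathbf 1_B(z)\langle Du(x),z\rangle]K^\sigma(z)\,dz .$$ Viscosity solutions. For $\delta\in(0,1)$, $\phi\in C^2$, bounded $u$ and $p\in\mathbb{R}^N$ set $\mathcal{I}[B_\delta](\phi,x)=\int_{B_\delta}[\phi(x+z,t)-\phi(x,t)-\mathbb{I}_\sigma\langle D\phi(x,t),z\rangle]K^\sigma(z)dz$ and $\mathcal{I}[B_\delta^c](u,p,x)=\int_{B_\delta^c}[u(x+z,t)-u(x,t)-\mathbb{I}_\sigma\mathbf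 1_B(z)\langle p,z\rangle]K^\sigma(z)dz$. A bounded upper semicontinuous (resp. lower semicontinuous) function $u$ on $\bar Q_T$ is a viscosity subsolution (resp. supersolution) of $u_t+F(x,Du,\mathcal{I}(u,x))=0$ in $Q_T$ if for every $(x,t)\in\mathbb{R}^N\times(0,T]$ and every $\phi\in C^2(\mathbb{R}^N\times(0,T])$ such that $(x,t)$ is a maximum (resp. minimum) point of $u-\phi$ in $B_\delta(x)\times(t-\delta,t+\delta)$ (intersected with $Q_T$) for a small $\delta>0$, one has $$\phi_t(x,t)+F\big(x,D\phi(x,t),\mathcal{I}[B_\delta](\phi,x)+\mathcal{I}[B_\delta^c](u,D\phi(x,t),x)\big)\le0\quad(\text{resp. }\ge0).$$ A bounded continuous function is a viscosity solution if it is both a sub- and a supersolution. *)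

theory Defs
  imports "HOL-Analysis.Analysis"
begin

definition modulus_of_continuity :: "(real \<Rightarrow> real) \<Rightarrow> bool" where
  "modulus_of_continuity \<omega> \<longleftrightarrow>
     (\<forall>t\<ge>0. 0 \<le> \<omega> t) \<and> mono_on {0..} \<omega> \<and> \<omega> 0 = 0 \<and> (\<omega> \<longlongrightarrow> 0) (at_right 0)"

definition usc_on :: "'a::topological_space set \<Rightarrow> ('a \<Rightarrow> real) \<Rightarrow> bool" where
  "usc_on S u \<longleftrightarrow> (\<forall>x\<in>S. \<forall>c>u x. \<forall>\<^sub>F y in at x within S. u y < c)"

definition lsc_on :: "'a::topological_space set \<Rightarrow> ('a \<Rightarrow> real) \<Rightarrow> bool" where
  "lsc_on S u \<longleftrightarrow> (\<forall>x\<in>S. \<forall>c<u x. \<forall>\<^sub>F y in at x within S. c < u y)"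

text \<open>Derivatives are taken within \<open>S\<close>. For \<open>S = \<real>\<^sup>N \<times> (0,T]\<close> they are uniquely determined; at the
  final time they are one-sided in time.\<close>

definition C2_on :: "'a::real_normed_vector set \<Rightarrow> ('a \<Rightarrow> real) \<Rightarrow> bool" where
  "C2_on S \<phi> \<longleftrightarrow>
     (\<exists>(D :: 'a \<Rightarrow> 'a \<Rightarrow>\<^sub>L real) (D2 :: 'a \<Rightarrow> 'a \<Rightarrow>\<^sub>L ('a \<Rightarrow>\<^sub>L real)).
        (\<forall>x\<in>S. (\<phi> has_derivative blinfun_apply (D x)) (at x within S)) \<and>
        (\<forall>x\<in>S. (D has_derivative blinfun_apply (D2 x)) (at x within S)) \<and>
        continuous_on S D2)"

definition grad :: "('a::real_inner \<Rightarrow> real) \<Rightarrow> 'a \<Rightarrow> 'a" where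
  "grad f x = (THE D. GDERIV f x :> D)"

definition parabolic_domain :: "real \<Rightarrow> ('a \<times> real) set" where
  "parabolic_domain T = UNIV \<times> {0<..T}"

definition closed_parabolic_domain :: "real \<Rightarrow> ('a \<times> real) set" where
  "closed_parabolic_domain T = UNIV \<times> {0..T}"

definition I_ind :: "real \<Rightarrow> real" where
  "I_ind \<sigma> = (if \<sigma> = 1 then 1 else 0)"

text \<open>The function arguments of the next two operators are space slices at a fixed time.\<close>

definition nonlocal_inner ::
    "real \<Rightarrow> ('a::euclidean_space \<Rightarrow> real) \<Rightarrow> real \<Rightarrow> ('a \<Rightarrow> real) \<Rightarrow> 'a \<Rightarrow> real" where
  "nonlocal_inner \<sigma> K \<delta> \<phi> x =
     (LINT z:ball 0 \<delta>|lebesgue. (\<phi> (x + z) - \<phi> x - I_ind \<sigma> * (grad \<phi> x \<bullet> z)) * K z)"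

definition nonlocal_outer ::
    "real \<Rightarrow> ('a::euclidean_space \<Rightarrow> real) \<Rightarrow> real \<Rightarrow> ('a \<Rightarrow> real) \<Rightarrow> 'a \<Rightarrow> 'a \<Rightarrow> real" where
  "nonlocal_outer \<sigma> K \<delta> u p x =
     (LINT z:- ball 0 \<delta>|lebesgue.
        (u (x + z) - u x - I_ind \<sigma> * indicator (ball 0 1) z * (p \<bullet> z)) * K z)"

text \<open>The left-hand side \<open>\<phi>\<^sub>t + F(x, D\<phi>, I[B\<^sub>\<delta>](\<phi>,x) + I[B\<^sub>\<delta>\<^sup>c](u,D\<phi>,x))\<close> of the viscosity
  inequalities at \<open>(x,t)\<close>.\<close>

definition visc_lhs ::
    "real \<Rightarrow> real \<Rightarrow> ('a::euclidean_space \<Rightarrow> real) \<Rightarrow> ('a \<Rightarrow> 'a \<Rightarrow> real \<Rightarrow> real) \<Rightarrow> real \<Rightarrow>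
     ('a \<times> real \<Rightarrow> real) \<Rightarrow> ('a \<times> real \<Rightarrow> real) \<Rightarrow> 'a \<Rightarrow> real \<Rightarrow> real" where
  "visc_lhs T \<sigma> K F \<delta> u \<phi> x t =
     (let p = grad (\<lambda>y. \<phi> (y, t)) x in
      vector_derivative (\<lambda>s. \<phi> (x, s)) (at t within {0<..T}) +
      F x p (nonlocal_inner \<sigma> K \<delta> (\<lambda>y. \<phi> (y, t)) x +
             nonlocal_outer \<sigma> K \<delta> (\<lambda>y. u (y, t)) p x))"

definition visc_subsolution ::
    "real \<Rightarrow> real \<Rightarrow> ('a::euclidean_space \<Rightarrow> real) \<Rightarrow> ('a \<Rightarrow> 'a \<Rightarrow> real \<Rightarrow> real) \<Rightarrow>
     ('a \<times> real \<Rightarrow> real) \<Rightarrow> bool" where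
  "visc_subsolution T \<sigma> K F u \<longleftrightarrow>
     bounded (u ` closed_parabolic_domain T) \<and> usc_on (closed_parabolic_domain T) u \<and>
     (\<forall>x t \<phi> \<delta>. (x, t) \<in> parabolic_domain T \<longrightarrow> C2_on (parabolic_domain T) \<phi> \<longrightarrow> 0 < \<delta> \<longrightarrow> \<delta> < 1 \<longrightarrow>
        (\<forall>(y, s) \<in> (ball x \<delta> \<times> {t - \<delta><..<t + \<delta>}) \<inter> parabolic_domain T.
           u (y, s) - \<phi> (y, s) \<le> u (x, t) - \<phi> (x, t)) \<longrightarrow>
        visc_lhs T \<sigma> K F \<delta> u \<phi> x t \<le> 0)"

definition visc_supersolution ::
    "real \<Rightarrow> real \<Rightarrow> ('a::euclidean_space \<Rightarrow> real) \<Rightarrow> ('a \<Rightarrow> 'a \<Rightarrow> real \<Rightarrow> real) \<Rightarrow>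
     ('a \<times> real \<Rightarrow> real) \<Rightarrow> bool" where
  "visc_supersolution T \<sigma> K F u \<longleftrightarrow>
     bounded (u ` closed_parabolic_domain T) \<and> lsc_on (closed_parabolic_domain T) u \<and>
     (\<forall>x t \<phi> \<delta>. (x, t) \<in> parabolic_domain T \<longrightarrow> C2_on (parabolic_domain T) \<phi> \<longrightarrow> 0 < \<delta> \<longrightarrow> \<delta> < 1 \<longrightarrow>
        (\<forall>(y, s) \<in> (ball x \<delta> \<times> {t - \<delta><..<t + \<delta>}) \<inter> parabolic_domain T.
           u (x, t) - \<phi> (x, t) \<le> u (y, s) - \<phi> (y, s)) \<longrightarrow>
        0 \<le> visc_lhs T \<sigma> K F \<delta> u \<phi> x t)"

definition visc_solution ::
    "real \<Rightarrow> real \<Rightarrow> ('a::euclidean_space \<Rightarrow> real) \<Rightarrow> ('a \<Rightarrow> 'a \<Rightarrow> real \<Rightarrow> real) \<Rightarrow>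
     ('a \<times> real \<Rightarrow> real) \<Rightarrow> bool" where
  "visc_solution T \<sigma> K F u \<longleftrightarrow>
     bounded (u ` closed_parabolic_domain T) \<and> continuous_on (closed_parabolic_domain T) u \<and>
     visc_subsolution T \<sigma> K F u \<and> visc_supersolution T \<sigma> K F u"

definition cauchy_visc_solution ::
    "real \<Rightarrow> real \<Rightarrow> ('a::euclidean_space \<Rightarrow> real) \<Rightarrow> ('a \<Rightarrow> 'a \<Rightarrow> real \<Rightarrow> real) \<Rightarrow>
     ('a \<Rightarrow> real) \<Rightarrow> ('a \<times> real \<Rightarrow> real) \<Rightarrow> bool" where
  "cauchy_visc_solution T \<sigma> K F u0 u \<longleftrightarrow>
     visc_solution T \<sigma> K F u \<and> (\<forall>x. u (x, 0) = u0 x)"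

definition attains_initial_with ::
    "real \<Rightarrow> ('a \<Rightarrow> real) \<Rightarrow> (real \<Rightarrow> real) \<Rightarrow> ('a \<times> real \<Rightarrow> real) \<Rightarrow> bool" where
  "attains_initial_with T u0 \<omega>0 u \<longleftrightarrow> (\<forall>t\<in>{0..T}. \<forall>x. \<bar>u (x, t) - u0 x\<bar> \<le> \<omega>0 t)"

end

theory Submission
  imports Defs
begin

text \<open>
  The sup-convolution in time \<open>U(x,t) = sup\<^sub>\<tau> (u(x,\<tau>) - G (\<tau> - t)\<^sup>2)\<close> of a subsolution \<open>u\<close> satisfies,
  at every point touched from above by a space function, the stationary inequality with a bounded
  right-hand side, so coercivity bounds \<open>|DU|\<^sup>m'\<close> by the size of the nonlocal term. If \<open>U\<close> is
  \<open>(1 - \<beta>)\<close>-Hoelder in space (\<open>\<beta> = 1\<close> is boundedness) and the order is at most one, that term is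
  \<open>O(r\<^bsup>-\<beta>\<^esup>)\<close> at scale \<open>r\<close>; sliding \<open>L |y - x|\<^bsup>1 - \<beta>/m'\<^esup>\<close> then shows that \<open>U\<close> is
  \<open>(1 - \<beta>/m')\<close>-Hoelder. Iterating, \<open>U\<close> is Hoelder with any exponent below one.
  Doubling the variables with \<open>|x - y|\<^sup>2/\<epsilon>\<^sup>2\<close>, the gradient and the nonlocal term of \<open>U\<close> are therefore
  bounded by \<open>\<epsilon>\<^bsup>-C\<beta>\<^esup>\<close>, and since \<open>|x - y| = O(\<epsilon>)\<close> the argument of the modulus in the structure condition
  is \<open>O(\<epsilon>\<^bsup>1/2\<^esup>)\<close> once \<open>\<beta>\<close> is small, whatever \<open>m\<close> and \<open>n\<close>. By concavity of powers only quadratic test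
  functions are needed.
\<close>

section \<open>Semicontinuous functions\<close>

text \<open>The obstacle is the weight \<open>(1 + |l| + |p|^m)^n\<close> multiplying
  \<open>|x1 - x2|\<close> in the structure condition. Bounds on the two functions alone give
  \<open>|x - y| = O(\<epsilon>)\<close> and gradients of order up to \<open>1 / \<epsilon>\<close>,
  which leaves the weighted product out of control. Regularity is needed on one side only.
  Degenerate ellipticity replaces the nonlocal term of the supersolution by that of \<open>U\<close>
  up to a small error, and the gradients at the two points almost agree, so the weight is governed
  by \<open>U\<close> alone. As \<open>F\<close> does not depend on time, the time penalty need not
  become infinite: the two test functions have time derivatives whose penalty parts cancel exactly.
  Hence \<open>G\<close> stays fixed. It only has to keep optimal times positive, and using the same
  \<open>G\<close> in the doubling makes the maximum over the time of \<open>u\<close> equal to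
  \<open>U\<close>. Close to the initial time the optimal time may be \<open>0\<close>, where no
  equation holds; there the ordering comes from the uniform attainment of \<open>u0\<close>.\<close>

lemma usc_on_iff_open:
  "usc_on S u \<longleftrightarrow> (\<forall>x\<in>S. \<forall>c>u x. \<exists>V. open V \<and> x \<in> V \<and> (\<forall>y\<in>V \<inter> S. u y < c))"
proof -
  have "(\<forall>\<^sub>F y in at x within S. u y < c) \<longleftrightarrow> (\<exists>V. open V \<and> x \<in> V \<and> (\<forall>y\<in>V \<inter> S. u y < c))"
    if "u x < c" for x c
  proof -
    \<comment> \<open>The filter \<open>at x within S\<close> omits \<open>x\<close> itself; since
      \<open>u x < c\<close>, including it changes nothing.\<close>
    have "(y \<noteq> x \<longrightarrow> y \<in> S \<longrightarrow> u y < c) \<longleftrightarrow> (y \<in> S \<longrightarrow> u y < c)" for y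
      using that by (cases "y = x") simp_all
    then show ?thesis
      unfolding eventually_at_topological Ball_def Int_iff by (simp only: imp_conjL)
  qed
  note * = this
  show ?thesis
    unfolding usc_on_def
  proof (rule ball_cong[OF refl], rule iff_allI, rule imp_cong[OF refl])
    fix x c assume "u x < c"
    then show "(\<forall>\<^sub>F y in at x within S. u y < c) \<longleftrightarrow> (\<exists>V. open V \<and> x \<in> V \<and> (\<forall>y\<in>V \<inter> S. u y < c))"
      by (rule *)
  qed
qed

lemma usc_onE:
  assumes "usc_on S u" "x \<in> S" "u x < c"
  obtains V where "open V" "x \<in> V" "\<And>y. y \<in> V \<Longrightarrow> y \<in> S \<Longrightarrow> u y < c"
proof -
  from assms have "\<exists>V. open V \<and> x \<in> V \<and> (\<forall>y\<in>V \<inter> S. u y < c)"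
    by (simp add: usc_on_iff_open)
  then obtain V where "open V" "x \<in> V" "\<forall>y\<in>V \<inter> S. u y < c"
    by (elim exE conjE)
  then show ?thesis
    by (intro that[of V]) auto
qed

lemma usc_on_uminus:
  assumes "lsc_on S u"
  shows "usc_on S (\<lambda>x. - u x)"
  unfolding usc_on_def
proof (intro ballI allI impI)
  fix x c assume "x \<in> S" "- u x < c"
  then have "\<forall>\<^sub>F y in at x within S. - c < u y"
    using assms by (simp add: lsc_on_def)
  then show "\<forall>\<^sub>F y in at x within S. - u y < c"
    by eventually_elim simp
qed

lemma usc_on_compose:
  assumes "usc_on S f" "continuous_on S' g" "g ` S' \<subseteq> S"
  shows "usc_on S' (\<lambda>x. f (g x))"
  unfolding usc_on_iff_open
proof (intro ballI allI impI)
  fix x c assume x: "x \<in> S'" and c: "f (g x) < c"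
  obtain V where V: "open V" "g x \<in> V" "\<And>y. y \<in> V \<Longrightarrow> y \<in> S \<Longrightarrow> f y < c"
    using x assms(3) by (rule_tac usc_onE[OF assms(1) _ c]) auto
  have "\<exists>W. open W \<and> W \<inter> S' = g -` V \<inter> S'"
    using assms(2) V(1) by (simp add: continuous_on_open_invariant)
  then obtain W where W: "open W" "W \<inter> S' = g -` V \<inter> S'"
    by (elim exE conjE)
  have "f (g y) < c" if "y \<in> W \<inter> S'" for y
    using that assms(3) unfolding W(2) by (intro V(3)) auto
  moreover have "x \<in> W"
    using W(2) V(2) x by fast
  ultimately show "\<exists>V. open V \<and> x \<in> V \<and> (\<forall>y\<in>V \<inter> S'. f (g y) < c)"
    using W(1) by (intro exI[of _ W]) simp
qed

lemma usc_on_add: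
  assumes "usc_on S f" "usc_on S g"
  shows "usc_on S (\<lambda>x. f x + g x)"
  unfolding usc_on_iff_open
proof (intro ballI allI impI)
  fix x c assume x: "x \<in> S" and c: "f x + g x < c"
  define d where "d = (c - f x - g x) / 2"
  have d: "d > 0" using c by (simp add: d_def)
  obtain V where V: "open V" "x \<in> V" "\<And>y. y \<in> V \<Longrightarrow> y \<in> S \<Longrightarrow> f y < f x + d"
    using d by (rule_tac usc_onE[OF assms(1) x, of "f x + d"]) auto
  obtain W where W: "open W" "x \<in> W" "\<And>y. y \<in> W \<Longrightarrow> y \<in> S \<Longrightarrow> g y < g x + d"
    using d by (rule_tac usc_onE[OF assms(2) x, of "g x + d"]) auto
  have "f y + g y < c" if "y \<in> V \<inter> W \<inter> S" for y
    using V(3)[of y] W(3)[of y] that by (auto simp: d_def field_simps)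
  then show "\<exists>V. open V \<and> x \<in> V \<and> (\<forall>y\<in>V \<inter> S. f y + g y < c)"
    using V W by (intro exI[of _ "V \<inter> W"]) (auto intro: open_Int)
qed

lemma continuous_imp_usc_on: "continuous_on S f \<Longrightarrow> usc_on S f"
  unfolding usc_on_def continuous_on_def by (auto intro: order_tendstoD)

text \<open>Without a maximum every \<open>x\<close> has a competitor \<open>m x\<close> with a
  larger value, and \<open>f < f (m x)\<close> near \<open>x\<close>. Among the finitely many
  competitors of a subcover the best one lies in some set of the cover, hence is beaten by
  another.\<close>

lemma usc_on_attains_sup:
  assumes "compact S" "S \<noteq> {}" "usc_on S f"
  shows "\<exists>x\<in>S. \<forall>y\<in>S. f y \<le> f x"
proof (rule ccontr)
  assume "\<not> ?thesis"
  then have *: "\<exists>y\<in>S. f x < f y" if "x \<in> S" for x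
    using that by (meson not_le)
  then obtain m where m: "\<And>x. x \<in> S \<Longrightarrow> m x \<in> S \<and> f x < f (m x)"
    by metis
  have "\<exists>V. open V \<and> x \<in> V \<and> (\<forall>y\<in>V \<inter> S. f y < f (m x))" if "x \<in> S" for x
    using assms(3) that m[OF that] unfolding usc_on_iff_open by blast
  then obtain V where V: "\<And>x. x \<in> S \<Longrightarrow> open (V x) \<and> x \<in> V x \<and> (\<forall>y\<in>V x \<inter> S. f y < f (m x))"
    by metis
  obtain D where D: "D \<subseteq> S" "finite D" "S \<subseteq> (\<Union>c\<in>D. V c)"
    using compactE_image[OF assms(1), of S V] V by blast
  have "D \<noteq> {}" using D assms(2) by auto
  define M where "M = Max ((\<lambda>x. f (m x)) ` D)"
  have "M \<in> (\<lambda>x. f (m x)) ` D"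
    unfolding M_def using D \<open>D \<noteq> {}\<close> by (intro Max_in) auto
  then obtain d where d: "d \<in> D" "M = f (m d)" by auto
  then have "m d \<in> S" using m D by auto
  then obtain e where e: "e \<in> D" "m d \<in> V e" using D by auto
  then have "f (m d) < f (m e)" using V D \<open>m d \<in> S\<close> by blast
  moreover have "f (m e) \<le> M" unfolding M_def using D e by auto
  ultimately show False using d by simp
qed

lemma usc_on_UNIV_borel_measurable:
  fixes f :: "'a::topological_space \<Rightarrow> real"
  assumes "usc_on UNIV f"
  shows "f \<in> borel_measurable borel"
proof -
  have "open {w. f w < a}" for a
  proof (subst open_subopen, intro ballI)
    fix x assume "x \<in> {w. f w < a}"
    then show "\<exists>V. open V \<and> x \<in> V \<and> V \<subseteq> {w. f w < a}"
      by (rule_tac usc_onE[OF assms, of x a]) auto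
  qed
  then show ?thesis
    by (subst borel_measurable_iff_less) auto
qed

text \<open>Compactness of \<open>C\<close> acts twice: the supremum over the fibre is attained, and
  an open set containing \<open>{x} \<times> C\<close> contains a tube around it, which gives
  semicontinuity in \<open>x\<close>. The second part makes the sup-convolution measurable.\<close>

lemma usc_on_SUP:
  fixes f :: "'a::topological_space \<times> 'b::topological_space \<Rightarrow> real"
  assumes "compact C" "C \<noteq> {}" "usc_on (UNIV \<times> C) f"
  shows "\<exists>\<tau>\<in>C. (SUP s\<in>C. f (x, s)) = f (x, \<tau>) \<and> (\<forall>s\<in>C. f (x, s) \<le> f (x, \<tau>))"
    and "usc_on UNIV (\<lambda>x. SUP s\<in>C. f (x, s))"
proof -
  show *: "\<exists>\<tau>\<in>C. (SUP s\<in>C. f (x, s)) = f (x, \<tau>) \<and> (\<forall>s\<in>C. f (x, s) \<le> f (x, \<tau>))" for x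
  proof -
    have "usc_on C (\<lambda>s. f (x, s))"
      by (rule usc_on_compose[OF assms(3)]) (auto intro!: continuous_intros)
    then obtain \<tau> where "\<tau> \<in> C" "\<forall>s\<in>C. f (x, s) \<le> f (x, \<tau>)"
      using usc_on_attains_sup[OF assms(1,2)] by blast
    moreover from this have "(SUP s\<in>C. f (x, s)) = f (x, \<tau>)"
      by (intro cSup_eq_maximum) auto
    ultimately show ?thesis by blast
  qed
  show "usc_on UNIV (\<lambda>x. SUP s\<in>C. f (x, s))"
    unfolding usc_on_iff_open
  proof (intro ballI allI impI)
    fix x c assume c: "(SUP s\<in>C. f (x, s)) < c"
    define \<V> where "\<V> = {V. open V \<and> (\<forall>y\<in>V \<inter> UNIV \<times> C. f y < c)}"
    define W where "W = \<Union>\<V>"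
    have "open W"
      unfolding W_def by (rule open_Union) (simp add: \<V>_def)
    have fW: "f y < c" if "y \<in> W" "y \<in> UNIV \<times> C" for y
      using that unfolding W_def \<V>_def by blast
    have "(x, s) \<in> W" if "s \<in> C" for s
    proof -
      obtain \<tau> where "(SUP s\<in>C. f (x, s)) = f (x, \<tau>)" "\<forall>s\<in>C. f (x, s) \<le> f (x, \<tau>)"
        using *[of x] by (elim bexE conjE)
      then have fxs: "f (x, s) < c" using c that by (intro le_less_trans[of "f (x, s)" "f (x, \<tau>)" c]) auto
      have mem: "(x, s) \<in> UNIV \<times> C" using that by simp
      from assms(3)[unfolded usc_on_iff_open, rule_format, OF mem fxs]
      obtain V where "open V" "(x, s) \<in> V" "\<forall>y\<in>V \<inter> UNIV \<times> C. f y < c"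
        by (elim exE conjE)
      then have "V \<in> \<V>" unfolding \<V>_def by (intro CollectI conjI)
      then show ?thesis using \<open>(x, s) \<in> V\<close> unfolding W_def by (rule UnionI)
    qed
    then have sub: "{x} \<times> C \<subseteq> W" by blast
    have "openin (prod_topology euclidean euclidean) W"
      using \<open>open W\<close> by simp
    then have "\<exists>A B. openin euclidean A \<and> openin euclidean B \<and> x \<in> A \<and> C \<subseteq> B \<and> A \<times> B \<subseteq> W"
      using sub assms(1) by (intro tube_lemma_right) simp_all
    then obtain A B where "openin euclidean A" "x \<in> A" "C \<subseteq> B" "A \<times> B \<subseteq> W"
      by (elim exE conjE)
    then have AB: "open A" "x \<in> A" "C \<subseteq> B" "A \<times> B \<subseteq> W" by simp_all
    have "(SUP s\<in>C. f (y, s)) < c" if "y \<in> A" for y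
    proof -
      obtain \<tau> where \<tau>: "\<tau> \<in> C" "(SUP s\<in>C. f (y, s)) = f (y, \<tau>)"
        using *[of y] by (elim bexE conjE)
      then have "(y, \<tau>) \<in> W" using AB that by blast
      then show ?thesis using fW \<tau> by simp
    qed
    then show "\<exists>V. open V \<and> x \<in> V \<and> (\<forall>y\<in>V \<inter> UNIV. (SUP s\<in>C. f (y, s)) < c)"
      using AB by (intro exI[of _ A]) simp
  qed
qed

section \<open>Integrals of powers of the norm\<close>

lemma dyadic_shell_above:
  fixes r \<delta> :: real
  assumes "0 < \<delta>" "\<delta> \<le> r"
  obtains k :: nat where "2 ^ k * \<delta> \<le> r" "r < 2 ^ Suc k * \<delta>"
proof -
  have "\<exists>k. r / \<delta> < 2 ^ k" by (rule real_arch_pow) simp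
  then have ex: "\<exists>k. r < 2 ^ k * \<delta>" using assms by (simp add: field_simps)
  define k where "k = (LEAST k. r < 2 ^ k * \<delta>)"
  have k: "r < 2 ^ k * \<delta>" unfolding k_def by (rule LeastI_ex[OF ex])
  then have "k \<noteq> 0" using assms by (intro notI) auto
  then obtain j where j: "k = Suc j" by (cases k) auto
  have "\<not> r < 2 ^ j * \<delta>"
  proof
    assume "r < 2 ^ j * \<delta>"
    then have "k \<le> j" unfolding k_def by (rule Least_le)
    then show False using j by simp
  qed
  then show ?thesis using that[of j] k j by simp
qed

lemma dyadic_shell_below:
  fixes r \<delta> :: real
  assumes "0 < r" "r < \<delta>"
  obtains k :: nat where "\<delta> / 2 ^ Suc k \<le> r" "r < \<delta> / 2 ^ k"
proof -
  have "\<exists>k. \<delta> / r < 2 ^ k" by (rule real_arch_pow) simp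
  then have ex: "\<exists>k. \<delta> / 2 ^ k \<le> r" using assms by (auto simp: field_simps intro: less_imp_le)
  define k where "k = (LEAST k. \<delta> / 2 ^ k \<le> r)"
  have k: "\<delta> / 2 ^ k \<le> r" unfolding k_def by (rule LeastI_ex[OF ex])
  then have "k \<noteq> 0" using assms by (intro notI) auto
  then obtain j where j: "k = Suc j" by (cases k) auto
  have "\<not> \<delta> / 2 ^ j \<le> r"
  proof
    assume "\<delta> / 2 ^ j \<le> r"
    then have "k \<le> j" unfolding k_def by (rule Least_le)
    then show False using j by simp
  qed
  then show ?thesis using that[of j] k j by simp
qed

text \<open>Whole balls stand in for dyadic shells: \<open>f\<close> is dominated pointwise by a
  series of multiples of ball indicators, whose volumes are explicit. Compared with shells this
  costs only a constant factor.\<close>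

lemma nn_integral_dyadic_bound:
  fixes f :: "'a::euclidean_space \<Rightarrow> real" and a R :: "nat \<Rightarrow> real"
  assumes dom: "\<And>z. 0 < f z \<Longrightarrow> \<exists>k. f z \<le> a k \<and> z \<in> ball 0 (R k)"
    and a: "\<And>k. 0 \<le> a k" and R: "\<And>k. 0 \<le> R k"
    and sums: "(\<lambda>k. a k * (unit_ball_vol DIM('a) * R k ^ DIM('a))) sums s"
  shows "(\<integral>\<^sup>+ z. ennreal (f z) \<partial>lebesgue) \<le> ennreal s"
proof -
  let ?g = "\<lambda>k (z::'a). ennreal (a k) * indicator (ball 0 (R k)) z"
  have le: "ennreal (f z) \<le> (\<Sum>k. ?g k z)" for z
  proof (cases "0 < f z")
    case True
    then obtain k where k: "f z \<le> a k" "z \<in> ball 0 (R k)" using dom by blast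
    then have "ennreal (f z) \<le> ?g k z" by (simp add: ennreal_leI)
    also have "\<dots> = (\<Sum>j\<in>{k}. ?g j z)"
      by (subst sum.insert) (simp_all only: finite.emptyI empty_iff not_False_eq_True sum.empty add_0_right)
    also have "\<dots> \<le> (\<Sum>k. ?g k z)" by (rule sum_le_suminf) auto
    finally show ?thesis .
  qed (simp add: ennreal_neg)
  have "(\<integral>\<^sup>+ z. ennreal (f z) \<partial>lebesgue) = (\<integral>\<^sup>+ z. ennreal (f z) \<partial>lborel)"
    by (rule nn_integral_completion)
  also have "\<dots> \<le> (\<integral>\<^sup>+ z. (\<Sum>k. ?g k z) \<partial>lborel)"
    by (intro nn_integral_mono le)
  also have "\<dots> = (\<Sum>k. \<integral>\<^sup>+ z. ?g k z \<partial>lborel)"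
    by (rule nn_integral_suminf, rule borel_measurable_times_ennreal)
      (auto intro!: borel_measurable_indicator)
  also have "\<dots> = (\<Sum>k. ennreal (a k * (unit_ball_vol DIM('a) * R k ^ DIM('a))))"
    using a R by (intro suminf_cong) (simp add: nn_integral_cmult_indicator emeasure_ball ennreal_mult)
  also have "\<dots> = ennreal s"
    using a R sums by (intro suminf_ennreal_eq) auto
  finally show ?thesis .
qed

lemma nn_integral_norm_powr_outside_ball:
  assumes "0 < b"
  shows "\<exists>A\<ge>0. \<forall>\<delta>>0.
    (\<integral>\<^sup>+ z. ennreal (indicator (- ball 0 \<delta>) z * norm z powr (- real DIM('a) - b)) \<partial>(lebesgue :: 'a::euclidean_space measure))
      \<le> ennreal (A * \<delta> powr - b)"
proof -
  let ?N = "real DIM('a)"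
  \<comment> \<open>Ratio of the geometric series: on shell \<open>k\<close> the volume is of order
    \<open>(2^k \<delta>)^N\<close> and the integrand of order
    \<open>(2^k \<delta>)^(-N - b)\<close>.\<close>
  define q where "q = 2 powr - b"
  have q: "0 < q" "q < 1" using assms by (simp_all add: q_def powr_less_one)
  have qk: "(2 ^ k) powr - b = q ^ k" for k :: nat
  proof -
    have "(2 ^ k) powr - b = (2 powr real k) powr - b" by (simp add: powr_realpow)
    also have "\<dots> = q powr real k" by (simp add: q_def powr_powr mult.commute)
    also have "\<dots> = q ^ k" using q by (simp add: powr_realpow)
    finally show ?thesis .
  qed
  define A where "A = unit_ball_vol ?N * 2 powr ?N / (1 - q)"
  have "A \<ge> 0" using q by (simp add: A_def)
  moreover have "(\<integral>\<^sup>+ z. ennreal (indicator (- ball 0 \<delta>) z * norm z powr (- ?N - b)) \<partial>(lebesgue::'a measure))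
      \<le> ennreal (A * \<delta> powr - b)" if \<delta>: "0 < \<delta>" for \<delta>
  proof (rule nn_integral_dyadic_bound[where a = "\<lambda>k. (2 ^ k * \<delta>) powr (- ?N - b)"
        and R = "\<lambda>k. 2 ^ Suc k * \<delta>"])
    fix z :: 'a assume "0 < indicator (- ball 0 \<delta>) z * norm z powr (- ?N - b)"
    then have z: "\<delta> \<le> norm z" by (cases "norm z < \<delta>") auto
    then obtain k where k: "2 ^ k * \<delta> \<le> norm z" "norm z < 2 ^ Suc k * \<delta>"
      using dyadic_shell_above[OF \<delta>] by blast
    have "norm z powr (- ?N - b) \<le> (2 ^ k * \<delta>) powr (- ?N - b)"
      using k \<delta> assms by (intro powr_mono2') auto
    then show "\<exists>k. indicator (- ball 0 \<delta>) z * norm z powr (- ?N - b) \<le> (2 ^ k * \<delta>) powr (- ?N - b)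
        \<and> z \<in> ball 0 (2 ^ Suc k * \<delta>)"
      using k z by (intro exI[of _ k]) (auto simp: indicator_def)
  next
    have eq: "(2 ^ k * \<delta>) powr (- ?N - b) * (unit_ball_vol ?N * (2 ^ Suc k * \<delta>) ^ DIM('a))
       = unit_ball_vol ?N * 2 powr ?N * \<delta> powr - b * q ^ k" for k :: nat
    proof -
      have "(2 ^ Suc k * \<delta>) ^ DIM('a) = (2 * (2 ^ k * \<delta>)) powr ?N"
        using \<delta> by (subst powr_realpow) (auto simp: mult_ac)
      also have "\<dots> = 2 powr ?N * (2 ^ k * \<delta>) powr ?N"
        using \<delta> by (subst powr_mult) auto
      finally have 1: "(2 ^ Suc k * \<delta>) ^ DIM('a) = 2 powr ?N * (2 ^ k * \<delta>) powr ?N" .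
      have 2: "(2 ^ k * \<delta>) powr (- ?N - b) * (2 ^ k * \<delta>) powr ?N = (2 ^ k * \<delta>) powr - b"
        by (subst powr_add[symmetric]) simp
      have 3: "(2 ^ k * \<delta>) powr - b = q ^ k * \<delta> powr - b"
        using \<delta> by (subst powr_mult) (auto simp: qk)
      show ?thesis unfolding 1 using 2 3 by (simp add: mult_ac)
    qed
    have "(\<lambda>k. q ^ k) sums (1 / (1 - q))" using q by (intro geometric_sums) auto
    from sums_mult[OF this, of "unit_ball_vol ?N * 2 powr ?N * \<delta> powr - b"]
    show "(\<lambda>k. (2 ^ k * \<delta>) powr (- ?N - b) * (unit_ball_vol ?N * (2 ^ Suc k * \<delta>) ^ DIM('a)))
      sums (A * \<delta> powr - b)"
      unfolding eq by (simp add: A_def mult_ac)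
  qed (use \<delta> in auto)
  ultimately show ?thesis by blast
qed

lemma nn_integral_norm_powr_inside_ball:
  assumes "0 < b"
  shows "\<exists>A\<ge>0. \<forall>\<delta>>0.
    (\<integral>\<^sup>+ z. ennreal (indicator (ball 0 \<delta> - {0}) z * norm z powr (- real DIM('a) + b)) \<partial>(lebesgue :: 'a::euclidean_space measure))
      \<le> ennreal (A * \<delta> powr b)"
proof -
  let ?N = "real DIM('a)"
  define q where "q = 2 powr - b"
  have q: "0 < q" "q < 1" using assms by (simp_all add: q_def powr_less_one)
  have qk: "(2 ^ k) powr - b = q ^ k" for k :: nat
  proof -
    have "(2 ^ k) powr - b = (2 powr real k) powr - b" by (simp add: powr_realpow)
    also have "\<dots> = q powr real k" by (simp add: q_def powr_powr mult.commute)
    also have "\<dots> = q ^ k" using q by (simp add: powr_realpow)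
    finally show ?thesis .
  qed
  \<comment> \<open>The exponent \<open>- N + b\<close> may have either sign, so the integrand is
    largest at the outer or at the inner radius of a shell; \<open>d\<close> covers both
    cases.\<close>
  define d where "d = max 1 (2 powr (?N - b))"
  define A where "A = unit_ball_vol ?N * d / (1 - q)"
  have "A \<ge> 0" using q by (simp add: A_def d_def)
  moreover have "(\<integral>\<^sup>+ z. ennreal (indicator (ball 0 \<delta> - {0}) z * norm z powr (- ?N + b)) \<partial>(lebesgue::'a measure))
      \<le> ennreal (A * \<delta> powr b)" if \<delta>: "0 < \<delta>" for \<delta>
  proof (rule nn_integral_dyadic_bound[where a = "\<lambda>k. d * (\<delta> / 2 ^ k) powr (- ?N + b)"
        and R = "\<lambda>k. \<delta> / 2 ^ k"])
    fix z :: 'a assume "0 < indicator (ball 0 \<delta> - {0}) z * norm z powr (- ?N + b)"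
    then have z: "0 < norm z" "norm z < \<delta>" by (cases "z = 0"; cases "norm z < \<delta>"; auto)+
    then obtain k where k: "\<delta> / 2 ^ Suc k \<le> norm z" "norm z < \<delta> / 2 ^ k"
      using dyadic_shell_below by blast
    have "norm z powr (- ?N + b) \<le> d * (\<delta> / 2 ^ k) powr (- ?N + b)"
    proof (cases "- ?N + b \<ge> 0")
      case True
      then have "norm z powr (- ?N + b) \<le> 1 * (\<delta> / 2 ^ k) powr (- ?N + b)"
        using k z by (auto intro: powr_mono2)
      also have "\<dots> \<le> d * (\<delta> / 2 ^ k) powr (- ?N + b)"
        by (intro mult_right_mono) (auto simp: d_def)
      finally show ?thesis .
    next
      case False
      then have "norm z powr (- ?N + b) \<le> (\<delta> / 2 ^ Suc k) powr (- ?N + b)"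
        using k \<delta> by (intro powr_mono2') auto
      also have "\<delta> / 2 ^ Suc k = (1/2) * (\<delta> / 2 ^ k)" by simp
      also have "\<dots> powr (- ?N + b) = 2 powr (?N - b) * (\<delta> / 2 ^ k) powr (- ?N + b)"
        using \<delta> by (subst powr_mult) (auto simp: powr_divide powr_diff powr_add powr_minus field_simps)
      also have "\<dots> \<le> d * (\<delta> / 2 ^ k) powr (- ?N + b)"
        by (intro mult_right_mono) (auto simp: d_def)
      finally show ?thesis .
    qed
    then show "\<exists>k. indicator (ball 0 \<delta> - {0}) z * norm z powr (- ?N + b) \<le> d * (\<delta> / 2 ^ k) powr (- ?N + b)
        \<and> z \<in> ball 0 (\<delta> / 2 ^ k)"
      using k z by (intro exI[of _ k]) (auto simp: indicator_def)
  next
    have eq: "d * (\<delta> / 2 ^ k) powr (- ?N + b) * (unit_ball_vol ?N * (\<delta> / 2 ^ k) ^ DIM('a))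
       = unit_ball_vol ?N * d * \<delta> powr b * q ^ k" for k :: nat
    proof -
      have 1: "(\<delta> / 2 ^ k) ^ DIM('a) = (\<delta> / 2 ^ k) powr ?N"
        using \<delta> by (subst powr_realpow) auto
      have 2: "(\<delta> / 2 ^ k) powr (- ?N + b) * (\<delta> / 2 ^ k) powr ?N = (\<delta> / 2 ^ k) powr b"
        by (subst powr_add[symmetric]) simp
      have 3: "(\<delta> / 2 ^ k) powr b = q ^ k * \<delta> powr b"
        using \<delta> by (subst powr_divide) (auto simp: qk[symmetric] powr_minus field_simps)
      show ?thesis unfolding 1 using 2 3 by (simp add: mult_ac)
    qed
    have "(\<lambda>k. q ^ k) sums (1 / (1 - q))" using q by (intro geometric_sums) auto
    from sums_mult[OF this, of "unit_ball_vol ?N * d * \<delta> powr b"]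
    show "(\<lambda>k. d * (\<delta> / 2 ^ k) powr (- ?N + b) * (unit_ball_vol ?N * (\<delta> / 2 ^ k) ^ DIM('a)))
      sums (A * \<delta> powr b)"
      unfolding eq by (simp add: A_def mult_ac)
  qed (use \<delta> in \<open>auto simp: d_def\<close>)
  ultimately show ?thesis by blast
qed

section \<open>Kernels of order at most one\<close>

lemma set_integrable_le_nn_integral:
  fixes f :: "'a \<Rightarrow> real"
  assumes "f \<in> borel_measurable M" "A \<in> sets M" "\<And>z. z \<in> A \<Longrightarrow> 0 \<le> f z"
    and "(\<integral>\<^sup>+ z. ennreal (indicator A z * f z) \<partial>M) \<le> ennreal B" "0 \<le> B"
  shows "set_integrable M A f" "(LINT z:A|M. f z) \<le> B"
proof -
  have m: "(\<lambda>z. indicator A z * f z) \<in> borel_measurable M"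
    using assms(1,2) by measurable
  have nn: "0 \<le> indicator A z * f z" for z
    using assms(3) by (auto simp: indicator_def)
  have fin: "(\<integral>\<^sup>+ z. ennreal (indicator A z * f z) \<partial>M) < \<infinity>"
    using assms(4) by (simp add: le_less_trans[OF _ ennreal_less_top])
  then have int: "integrable M (\<lambda>z. indicator A z * f z)"
    using m nn by (intro integrableI_nonneg) auto
  then show "set_integrable M A f"
    by (simp add: set_integrable_def)
  have "ennreal (\<integral>z. indicator A z * f z \<partial>M) = (\<integral>\<^sup>+ z. ennreal (indicator A z * f z) \<partial>M)"
    using int nn by (intro nn_integral_eq_integral[symmetric]) auto
  then show "(LINT z:A|M. f z) \<le> B"
    using assms(4,5) by (simp add: set_lebesgue_integral_def ennreal_le_iff flip: ennreal_le_iff[OF assms(5)])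
qed

lemma set_integrable_dominated:
  fixes f g :: "'a::euclidean_space \<Rightarrow> real"
  assumes "f \<in> borel_measurable lebesgue" "A \<in> sets lebesgue"
    and "\<And>z. z \<in> A \<Longrightarrow> 0 \<le> f z" "\<And>z. z \<in> A \<Longrightarrow> f z \<le> D * g z"
    and "(\<integral>\<^sup>+ z. ennreal (indicator A z * g z) \<partial>lebesgue) \<le> ennreal B"
    and "0 \<le> B" "0 \<le> D" "\<And>z. 0 \<le> g z" "g \<in> borel_measurable lebesgue"
  shows "set_integrable lebesgue A f" "(LINT z:A|lebesgue. f z) \<le> D * B"
proof -
  have "(\<integral>\<^sup>+ z. ennreal (indicator A z * f z) \<partial>lebesgue)
      \<le> (\<integral>\<^sup>+ z. ennreal D * ennreal (indicator A z * g z) \<partial>lebesgue)"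
  proof (rule nn_integral_mono)
    fix z
    have "indicator A z * f z \<le> D * (indicator A z * g z)"
      using assms(4)[of z] by (cases "z \<in> A") auto
    then show "ennreal (indicator A z * f z) \<le> ennreal D * ennreal (indicator A z * g z)"
      using assms(7,8) by (simp add: ennreal_mult[symmetric] ennreal_leI)
  qed
  also have "\<dots> = ennreal D * (\<integral>\<^sup>+ z. ennreal (indicator A z * g z) \<partial>lebesgue)"
    using assms(2,9)
    by (intro nn_integral_cmult borel_measurable_times measurable_compose[OF _ measurable_ennreal]) simp_all
  also have "\<dots> \<le> ennreal D * ennreal B"
    by (intro mult_left_mono assms(5)) simp
  also have "\<dots> = ennreal (D * B)"
    using assms(6,7) by (simp add: ennreal_mult)
  finally have *: "(\<integral>\<^sup>+ z. ennreal (indicator A z * f z) \<partial>lebesgue) \<le> ennreal (D * B)" .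
  have DB: "0 \<le> D * B" using assms(6,7) by simp
  show "set_integrable lebesgue A f" "(LINT z:A|lebesgue. f z) \<le> D * B"
    using set_integrable_le_nn_integral[OF assms(1-3) * DB] by simp_all
qed

lemma borel_measurable_norm_powr [measurable]:
  "(\<lambda>z::'a::euclidean_space. norm z powr b) \<in> borel_measurable lebesgue"
  by (intro measurable_completion) measurable

text \<open>The bound on \<open>K\<close> leaves out \<open>z = 0\<close> because
  \<open>0 powr x = 0\<close> would otherwise force \<open>K 0 = 0\<close>.\<close>

locale small_order_kernel =
  fixes \<sigma> :: real and K :: "'a::euclidean_space \<Rightarrow> real" and Kb :: real
  assumes \<sigma>_pos: "0 < \<sigma>" and \<sigma>_le: "\<sigma> \<le> 1"
    and K_nonneg: "\<And>z. 0 \<le> K z"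
    and K_meas [measurable]: "K \<in> borel_measurable lebesgue"
    and Kb_nonneg: "0 \<le> Kb"
    and K_le: "\<And>z. z \<noteq> 0 \<Longrightarrow> K z \<le> Kb * norm z powr (- real DIM('a) - \<sigma>)"
begin

lemma K_integrable_outside:
  assumes "0 < \<delta>"
  shows "set_integrable lebesgue (- ball 0 \<delta>) K"
proof -
  obtain A where A: "0 \<le> A" "\<forall>\<delta>>0. (\<integral>\<^sup>+ z. ennreal (indicator (- ball 0 \<delta>) z * norm z powr (- real DIM('a) - \<sigma>)) \<partial>(lebesgue :: 'a measure))
      \<le> ennreal (A * \<delta> powr - \<sigma>)"
    using nn_integral_norm_powr_outside_ball[OF \<sigma>_pos, where 'a = 'a] by blast
  show ?thesis
    by (rule set_integrable_dominated(1)[OF _ _ _ _ A(2)[rule_format, OF assms], of _ Kb])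
      (use A assms Kb_nonneg K_nonneg in \<open>auto intro!: K_le\<close>)
qed

definition tail :: "real \<Rightarrow> real" where
  "tail \<delta> = (LINT z:- ball 0 \<delta>|lebesgue. K z)"

lemma tail_nonneg: "0 \<le> tail \<delta>"
  unfolding tail_def set_lebesgue_integral_def using K_nonneg by (intro Bochner_Integration.integral_nonneg) auto

text \<open>Size of the nonlocal operator on the annulus for increments of order
  \<open>|z|^(1 - b)\<close>. It serves both for Hoelder functions and, with a small power lost, for
  the linear compensator.\<close>

definition shell :: "real \<Rightarrow> real \<Rightarrow> real" where
  "shell b \<delta> = (LINT z:ball 0 1 - ball 0 \<delta>|lebesgue. norm z powr (1 - b) * K z)"

lemma shell_nonneg: "0 \<le> shell b \<delta>"
  unfolding shell_def set_lebesgue_integral_def using K_nonneg by (intro Bochner_Integration.integral_nonneg) auto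

text \<open>Inside the unit ball \<open>|z|^(1 - b) * K z\<close> is at most
  \<open>Kb * |z|^(-N - b)\<close>, by \<open>\<sigma> \<le> 1\<close>. A positive \<open>b\<close>
  avoids the logarithm that can appear for \<open>\<sigma> = 1\<close> and
  \<open>b = 0\<close>.\<close>

lemma shell_bound:
  assumes "0 < b"
  shows "\<exists>A\<ge>0. \<forall>\<delta>>0. set_integrable lebesgue (ball 0 1 - ball 0 \<delta>) (\<lambda>z. norm z powr (1 - b) * K z)
     \<and> shell b \<delta> \<le> A * \<delta> powr - b"
proof -
  obtain A where A: "0 \<le> A" "\<forall>\<delta>>0. (\<integral>\<^sup>+ z. ennreal (indicator (- ball 0 \<delta>) z * norm z powr (- real DIM('a) - b)) \<partial>(lebesgue :: 'a measure))
      \<le> ennreal (A * \<delta> powr - b)"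
    using nn_integral_norm_powr_outside_ball[OF assms, where 'a = 'a] by blast
  have main: "set_integrable lebesgue (ball 0 1 - ball 0 \<delta>) (\<lambda>z. norm z powr (1 - b) * K z)
     \<and> shell b \<delta> \<le> Kb * (A * \<delta> powr - b)" if \<delta>: "0 < \<delta>" for \<delta>
  proof -
    have nn: "(\<integral>\<^sup>+ z. ennreal (indicator (ball 0 1 - ball 0 \<delta>) z * norm z powr (- real DIM('a) - b)) \<partial>(lebesgue :: 'a measure))
      \<le> ennreal (A * \<delta> powr - b)"
      by (rule order_trans[OF nn_integral_mono A(2)[rule_format, OF \<delta>]])
        (auto simp: indicator_def)
    have le: "norm z powr (1 - b) * K z \<le> Kb * norm z powr (- real DIM('a) - b)"
      if z: "z \<in> ball 0 1 - ball 0 \<delta>" for z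
    proof -
      have z0: "z \<noteq> 0" "0 < norm z" "norm z \<le> 1" using z \<delta> by auto
      have "norm z powr (1 - b) * K z \<le> norm z powr (1 - b) * (Kb * norm z powr (- real DIM('a) - \<sigma>))"
        using K_le z0 by (intro mult_left_mono) auto
      also have "\<dots> = Kb * norm z powr ((1 - b) + (- real DIM('a) - \<sigma>))"
        by (simp add: powr_add)
      also have "\<dots> \<le> Kb * norm z powr (- real DIM('a) - b)"
        using z0 \<sigma>_le Kb_nonneg by (intro mult_left_mono powr_mono') auto
      finally show ?thesis .
    qed
    have B: "0 \<le> A * \<delta> powr - b" using A by simp
    show ?thesis
      unfolding shell_def
      by (rule conjI; rule set_integrable_dominated[OF _ _ _ le nn B Kb_nonneg])
        (use K_nonneg in auto)
  qed
  show ?thesis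
    by (rule exI[of _ "Kb * A"]) (use main A Kb_nonneg in \<open>simp add: mult.assoc\<close>)
qed

definition M2 :: "real \<Rightarrow> real" where
  "M2 \<delta> = (LINT z:ball 0 \<delta>|lebesgue. (norm z)\<^sup>2 * K z)"

lemma M2_nonneg: "0 \<le> M2 \<delta>"
  unfolding M2_def set_lebesgue_integral_def using K_nonneg by (intro Bochner_Integration.integral_nonneg) auto

lemma inside_bound:
  assumes "\<sigma> < b"
  shows "\<exists>A\<ge>0. \<forall>\<delta>>0. set_integrable lebesgue (ball 0 \<delta>) (\<lambda>z. norm z powr b * K z)
     \<and> (LINT z:ball 0 \<delta>|lebesgue. norm z powr b * K z) \<le> A * \<delta> powr (b - \<sigma>)"
proof -
  have b: "0 < b - \<sigma>" using assms by simp
  obtain A where A: "0 \<le> A" "\<forall>\<delta>>0. (\<integral>\<^sup>+ z. ennreal (indicator (ball 0 \<delta> - {0}) z * norm z powr (- real DIM('a) + (b - \<sigma>))) \<partial>(lebesgue :: 'a measure))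
      \<le> ennreal (A * \<delta> powr (b - \<sigma>))"
    using nn_integral_norm_powr_inside_ball[OF b, where 'a = 'a] by blast
  have main: "set_integrable lebesgue (ball 0 \<delta>) (\<lambda>z. norm z powr b * K z)
     \<and> (LINT z:ball 0 \<delta>|lebesgue. norm z powr b * K z) \<le> Kb * (A * \<delta> powr (b - \<sigma>))" if \<delta>: "0 < \<delta>" for \<delta>
  proof -
    have nn: "(\<integral>\<^sup>+ z. ennreal (indicator (ball 0 \<delta>) z * norm z powr (- real DIM('a) + (b - \<sigma>))) \<partial>(lebesgue :: 'a measure))
      \<le> ennreal (A * \<delta> powr (b - \<sigma>))"
      by (rule order_trans[OF nn_integral_mono A(2)[rule_format, OF \<delta>]])
        (auto simp: indicator_def)
    have le: "norm z powr b * K z \<le> Kb * norm z powr (- real DIM('a) + (b - \<sigma>))" for z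
    proof (cases "z = 0")
      case False
      then have "norm z powr b * K z \<le> norm z powr b * (Kb * norm z powr (- real DIM('a) - \<sigma>))"
        using K_le by (intro mult_left_mono) auto
      also have "\<dots> = Kb * norm z powr (b + (- real DIM('a) - \<sigma>))"
        by (simp add: powr_add)
      finally show ?thesis by (simp add: algebra_simps)
    qed simp
    have B: "0 \<le> A * \<delta> powr (b - \<sigma>)" using A by simp
    show ?thesis
      by (rule conjI; rule set_integrable_dominated[OF _ _ _ le nn B Kb_nonneg])
        (use K_nonneg in auto)
  qed
  show ?thesis
    by (rule exI[of _ "Kb * A"]) (use main A Kb_nonneg in \<open>simp add: mult.assoc\<close>)
qed

text \<open>The natural rate is \<open>\<delta> powr (2 - \<sigma>)\<close>;
  \<open>\<sigma> \<le> 1\<close> turns it into a linear one, which is the form used for choosing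
  radii.\<close>

lemma M2_bound:
  "\<exists>A\<ge>0. \<forall>\<delta>. 0 < \<delta> \<longrightarrow> \<delta> \<le> 1 \<longrightarrow>
     set_integrable lebesgue (ball 0 \<delta>) (\<lambda>z. (norm z)\<^sup>2 * K z) \<and> M2 \<delta> \<le> A * \<delta>"
proof -
  have eq: "norm z powr 2 = (norm z)\<^sup>2" for z :: 'a
    by (cases "z = 0") (simp_all add: powr_numeral)
  obtain A where A: "A \<ge> 0" "\<forall>\<delta>>0. set_integrable lebesgue (ball 0 \<delta>) (\<lambda>z. (norm z)\<^sup>2 * K z)
     \<and> M2 \<delta> \<le> A * \<delta> powr (2 - \<sigma>)"
    using inside_bound[of 2] \<sigma>_le unfolding eq M2_def by auto
  have "A * \<delta> powr (2 - \<sigma>) \<le> A * \<delta>" if "0 < \<delta>" "\<delta> \<le> 1" for \<delta>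
  proof -
    have "\<delta> powr (2 - \<sigma>) \<le> \<delta> powr 1"
      using that \<sigma>_le by (intro powr_mono') auto
    then show ?thesis using A that by (intro mult_left_mono) auto
  qed
  then show ?thesis using A by (meson order_trans)
qed

text \<open>First-order part of the inner integral that is left after compensation. It vanishes for
  \<open>\<sigma> = 1\<close>; for \<open>\<sigma> < 1\<close> it converges because the first moment
  of \<open>K\<close> near the origin is finite.\<close>

definition drift :: "real \<Rightarrow> 'a \<Rightarrow> real" where
  "drift \<delta> p = (LINT z:ball 0 \<delta>|lebesgue. (1 - I_ind \<sigma>) * (p \<bullet> z) * K z)"

lemma drift_integrable:
  assumes "0 < \<delta>"
  shows "set_integrable lebesgue (ball 0 \<delta>) (\<lambda>z. (1 - I_ind \<sigma>) * (p \<bullet> z) * K z)"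
proof (cases "\<sigma> = 1")
  case True
  then show ?thesis by (simp add: I_ind_def set_integrable_def)
next
  case False
  then have "\<sigma> < 1" using \<sigma>_le by simp
  have eq: "norm z powr 1 = norm z" for z :: 'a by simp
  have i: "set_integrable lebesgue (ball 0 \<delta>) (\<lambda>z. norm z * K z)"
    using inside_bound[OF \<open>\<sigma> < 1\<close>] assms unfolding eq by blast
  have m: "(\<lambda>z::'a. p \<bullet> z) \<in> borel_measurable lebesgue"
    by (intro measurable_completion) auto
  show ?thesis
  proof (rule set_integrable_bound[OF set_integrable_mult_right[OF i, of "norm p"]])
    show "set_borel_measurable lebesgue (ball 0 \<delta>) (\<lambda>z. (1 - I_ind \<sigma>) * (p \<bullet> z) * K z)"
      unfolding set_borel_measurable_def
      by (intro borel_measurable_scaleR borel_measurable_indicator borel_measurable_times m K_meas) auto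
    have "\<bar>p \<bullet> z\<bar> * K z \<le> norm p * norm z * K z" for z
      using K_nonneg by (intro mult_right_mono Cauchy_Schwarz_ineq2)
    then show "AE z in lebesgue. z \<in> ball 0 \<delta> \<longrightarrow> norm ((1 - I_ind \<sigma>) * (p \<bullet> z) * K z) \<le> norm (norm p * (norm z * K z))"
      using False K_nonneg by (intro AE_I2) (simp add: I_ind_def abs_mult mult.assoc)
  qed
qed

lemma drift_diff: "0 < \<delta> \<Longrightarrow> drift \<delta> (p - q) = drift \<delta> p - drift \<delta> q"
  unfolding drift_def inner_diff_left
  using set_integral_diff(2)[OF drift_integrable[of \<delta> p] drift_integrable[of \<delta> q]]
  by (simp add: right_diff_distrib left_diff_distrib)

lemma drift_bound: "\<exists>A\<ge>0. \<forall>\<delta> p. 0 < \<delta> \<longrightarrow> \<delta> \<le> 1 \<longrightarrow> \<bar>drift \<delta> p\<bar> \<le> A * norm p"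
proof (cases "\<sigma> = 1")
  case True
  then have I: "I_ind \<sigma> = 1" by (simp add: I_ind_def)
  then show ?thesis by (intro exI[of _ 0]) (simp add: drift_def I)
next
  case False
  then have "\<sigma> < 1" using \<sigma>_le by simp
  have eq: "norm z powr 1 = norm z" for z :: 'a by simp
  obtain A where A: "A \<ge> 0" "\<forall>\<delta>>0. set_integrable lebesgue (ball 0 \<delta>) (\<lambda>z. norm z * K z)
     \<and> (LINT z:ball 0 \<delta>|lebesgue. norm z * K z) \<le> A * \<delta> powr (1 - \<sigma>)"
    using inside_bound[OF \<open>\<sigma> < 1\<close>] unfolding eq by blast
  have "\<bar>drift \<delta> p\<bar> \<le> A * norm p" if \<delta>: "0 < \<delta>" "\<delta> \<le> 1" for \<delta> p
  proof -
    have le: "norm ((1 - I_ind \<sigma>) * (p \<bullet> z) * K z) \<le> norm p * (norm z * K z)" for z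
    proof -
      have "\<bar>p \<bullet> z\<bar> * K z \<le> norm p * norm z * K z"
        using K_nonneg by (intro mult_right_mono Cauchy_Schwarz_ineq2)
      then show ?thesis using False K_nonneg by (simp add: I_ind_def abs_mult mult.assoc)
    qed
    have i: "set_integrable lebesgue (ball 0 \<delta>) (\<lambda>z. norm p * (norm z * K z))"
      using A \<delta> by (intro set_integrable_mult_right) auto
    have "\<bar>drift \<delta> p\<bar> \<le> (LINT z:ball 0 \<delta>|lebesgue. norm ((1 - I_ind \<sigma>) * (p \<bullet> z) * K z))"
      unfolding drift_def using drift_integrable[OF \<delta>(1), of p]
      by (metis real_norm_def set_integral_norm_bound)
    also have "\<dots> \<le> (LINT z:ball 0 \<delta>|lebesgue. norm p * (norm z * K z))"
      using i drift_integrable[OF \<delta>(1), of p] le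
      by (intro set_integral_mono set_integrable_norm) auto
    also have "\<dots> \<le> norm p * (A * \<delta> powr (1 - \<sigma>))"
      using A \<delta> by (simp add: mult_left_mono)
    also have "\<dots> \<le> norm p * (A * 1)"
      using A \<delta> \<sigma>_le by (intro mult_left_mono powr_le1) auto
    finally show ?thesis by (simp add: mult.commute)
  qed
  then show ?thesis using A by blast
qed

end

section \<open>Quadratic test functions\<close>

text \<open>Up to additive constants, which do not affect touching, this family contains every sum
  of squared distances to fixed points, in space and in time, that the proof tests with.\<close>

definition quad :: "real \<Rightarrow> 'a::real_inner \<Rightarrow> real \<Rightarrow> real \<Rightarrow> 'a \<times> real \<Rightarrow> real" where
  "quad \<kappa> b G h z = \<kappa> * (fst z \<bullet> fst z) + b \<bullet> fst z + G * (snd z)\<^sup>2 + h * snd z"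

lemma C2_on_quad: "C2_on S (quad \<kappa> b G h)"
proof -
  define D where "D z = blinfun_inner_left ((2 * \<kappa>) *\<^sub>R fst z + b, 2 * G * snd z + h)" for z :: "'a \<times> real"
  define d2 where "d2 v = blinfun_inner_left ((2 * \<kappa>) *\<^sub>R fst v, 2 * G * snd v)" for v :: "'a \<times> real"
  have d2: "bounded_linear d2"
    unfolding d2_def
    by (intro bounded_linear_compose[OF bounded_linear_blinfun_inner_left] bounded_linear_Pair
        bounded_linear_const_scaleR bounded_linear_const_mult bounded_linear_fst bounded_linear_snd)
  have 1: "(quad \<kappa> b G h has_derivative blinfun_apply (D z)) (at z within S)" for z
    unfolding quad_def [abs_def] D_def
    by (auto intro!: derivative_eq_intros simp: inner_commute algebra_simps inner_add_left)
  have 2: "(D has_derivative blinfun_apply (Blinfun d2)) (at z within S)" for z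
    unfolding bounded_linear_Blinfun_apply[OF d2] unfolding D_def [abs_def] d2_def
    by (rule bounded_linear.has_derivative[OF bounded_linear_blinfun_inner_left])
      (auto intro!: derivative_eq_intros)
  show ?thesis
    unfolding C2_on_def
    by (rule exI[of _ D], rule exI[of _ "\<lambda>_. Blinfun d2"]) (use 1 2 in simp)
qed

lemma grad_quad: "grad (\<lambda>y. quad \<kappa> b G h (y, t)) x = (2 * \<kappa>) *\<^sub>R x + b"
proof -
  have g: "GDERIV (\<lambda>y. quad \<kappa> b G h (y, t)) x :> (2 * \<kappa>) *\<^sub>R x + b"
    unfolding gderiv_def quad_def
    by (auto intro!: derivative_eq_intros simp: inner_commute algebra_simps inner_add_left)
  show ?thesis
    unfolding grad_def
  proof (rule the_equality)
    show "GDERIV (\<lambda>y. quad \<kappa> b G h (y, t)) x :> (2 * \<kappa>) *\<^sub>R x + b" by (rule g)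
    fix D assume "GDERIV (\<lambda>y. quad \<kappa> b G h (y, t)) x :> D"
    then have "(\<lambda>h. h \<bullet> D) = (\<lambda>v. v \<bullet> ((2 * \<kappa>) *\<^sub>R x + b))"
      using g unfolding gderiv_def by (rule has_derivative_unique)
    then show "D = (2 * \<kappa>) *\<^sub>R x + b"
      by (metis vector_eq_rdot inner_commute)
  qed
qed

lemma vector_derivative_quad:
  assumes "0 < t" "t \<le> T"
  shows "vector_derivative (\<lambda>s. quad \<kappa> b G h (x, s)) (at t within {0<..T}) = 2 * G * t + h"
proof (rule vector_derivative_within)
  \<comment> \<open>Times below \<open>t\<close> suffice, so the final time \<open>t = T\<close>
    needs no separate treatment.\<close>
  have "t islimpt {0<..T}"
    using islimpt_greaterThanLessThan2[OF assms(1)] by (rule islimpt_subset) (use assms in auto)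
  then show "at t within {0<..T} \<noteq> bot"
    by (simp add: trivial_limit_within)
  have "((\<lambda>s. quad \<kappa> b G h (x, s)) has_real_derivative 2 * G * t + h) (at t within {0<..T})"
    unfolding quad_def by (auto intro!: derivative_eq_intros)
  then show "((\<lambda>s. quad \<kappa> b G h (x, s)) has_vector_derivative 2 * G * t + h) (at t within {0<..T})"
    by (simp add: has_real_derivative_iff_has_vector_derivative)
qed

context small_order_kernel
begin

text \<open>The expansion \<open>p \<bullet> z + \<kappa> * |z|^2\<close> of a quadratic is exact,
  so the inner operator is known without error: a multiple of the second moment plus the
  uncompensated first-order part.\<close>

lemma nonlocal_inner_quad:
  assumes "0 < \<delta>" "\<delta> < 1"
  shows "nonlocal_inner \<sigma> K \<delta> (\<lambda>y. quad \<kappa> b G h (y, t)) x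
    = \<kappa> * M2 \<delta> + drift \<delta> ((2 * \<kappa>) *\<^sub>R x + b)"
proof -
  define p where "p = (2 * \<kappa>) *\<^sub>R x + b"
  have i: "set_integrable lebesgue (ball 0 \<delta>) (\<lambda>z. \<kappa> * ((norm z)\<^sup>2 * K z))"
    using M2_bound assms by (intro set_integrable_mult_right) fastforce
  have eq: "(quad \<kappa> b G h (x + z, t) - quad \<kappa> b G h (x, t) - I_ind \<sigma> * (p \<bullet> z)) * K z
      = \<kappa> * ((norm z)\<^sup>2 * K z) + (1 - I_ind \<sigma>) * (p \<bullet> z) * K z" for z
    unfolding quad_def p_def
    by (simp add: inner_add_left inner_add_right inner_commute[of z x] power2_norm_eq_inner algebra_simps)
  have "nonlocal_inner \<sigma> K \<delta> (\<lambda>y. quad \<kappa> b G h (y, t)) x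
    = (LINT z:ball 0 \<delta>|lebesgue. \<kappa> * ((norm z)\<^sup>2 * K z) + (1 - I_ind \<sigma>) * (p \<bullet> z) * K z)"
    unfolding nonlocal_inner_def grad_quad p_def[symmetric] eq ..
  also have "\<dots> = \<kappa> * M2 \<delta> + drift \<delta> p"
    unfolding M2_def drift_def
    using set_integral_add(2)[OF i drift_integrable[OF assms(1), of p]] by simp
  finally show ?thesis unfolding p_def .
qed

lemma visc_lhs_quad:
  assumes "0 < \<delta>" "\<delta> < 1" "0 < t" "t \<le> T"
  shows "visc_lhs T \<sigma> K F \<delta> u (quad \<kappa> b G h) x t = 2 * G * t + h +
    F x ((2 * \<kappa>) *\<^sub>R x + b) (\<kappa> * M2 \<delta> + drift \<delta> ((2 * \<kappa>) *\<^sub>R x + b)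
      + nonlocal_outer \<sigma> K \<delta> (\<lambda>y. u (y, t)) ((2 * \<kappa>) *\<^sub>R x + b) x)"
  unfolding visc_lhs_def Let_def grad_quad vector_derivative_quad[OF assms(3,4)]
    nonlocal_inner_quad[OF assms(1,2)] ..

section \<open>The nonlocal operator outside a ball: integrability, comparison and size\<close>

definition outer_integrand :: "('a \<Rightarrow> real) \<Rightarrow> 'a \<Rightarrow> 'a \<Rightarrow> 'a \<Rightarrow> real" where
  "outer_integrand w p x z = (w (x + z) - w x - I_ind \<sigma> * indicator (ball 0 1) z * (p \<bullet> z)) * K z"

lemma nonlocal_outer_alt:
  "nonlocal_outer \<sigma> K \<delta> w p x = (LINT z:- ball 0 \<delta>|lebesgue. outer_integrand w p x z)"
  unfolding nonlocal_outer_def outer_integrand_def ..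

lemma I_ind_bounds: "0 \<le> I_ind \<sigma>" "I_ind \<sigma> \<le> 1"
  by (simp_all add: I_ind_def)

lemma compensator_le: "\<bar>I_ind \<sigma> * indicator (ball 0 1) z * (p \<bullet> z)\<bar> \<le> norm p * (norm z * indicator (ball 0 1) z)"
proof -
  have "\<bar>I_ind \<sigma> * indicator (ball 0 1) z * (p \<bullet> z)\<bar> = I_ind \<sigma> * (indicator (ball 0 1) z * \<bar>p \<bullet> z\<bar>)"
    using I_ind_bounds by (simp add: abs_mult)
  also have "\<dots> \<le> 1 * (indicator (ball 0 1) z * (norm p * norm z))"
    using I_ind_bounds by (intro mult_mono Cauchy_Schwarz_ineq2) auto
  finally show ?thesis by (simp add: mult_ac)
qed

lemma outer_integrand_measurable:
  assumes [measurable]: "w \<in> borel_measurable borel"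
  shows "outer_integrand w p x \<in> borel_measurable lebesgue"
proof -
  have "(\<lambda>z. w (x + z)) \<in> borel_measurable borel"
    by (rule measurable_compose[OF _ assms]) simp
  then have 1: "(\<lambda>z. w (x + z)) \<in> borel_measurable lebesgue"
    by (intro measurable_completion) simp
  have 2: "(\<lambda>z::'a. p \<bullet> z) \<in> borel_measurable lebesgue"
    by (intro measurable_completion) auto
  show ?thesis
    unfolding outer_integrand_def [abs_def]
    by (intro borel_measurable_times borel_measurable_diff 1 2 K_meas borel_measurable_indicator) auto
qed

lemma outer_integrable:
  assumes "w \<in> borel_measurable borel" "\<And>y. \<bar>w y\<bar> \<le> M" "0 < \<delta>"
  shows "set_integrable lebesgue (- ball 0 \<delta>) (outer_integrand w p x)"
proof (rule set_integrable_bound[OF set_integrable_mult_right[OF K_integrable_outside[OF assms(3)], of "2 * M + norm p"]])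
  show "set_borel_measurable lebesgue (- ball 0 \<delta>) (outer_integrand w p x)"
    unfolding set_borel_measurable_def
    by (intro borel_measurable_scaleR borel_measurable_indicator outer_integrand_measurable assms) auto
  have "norm (outer_integrand w p x z) \<le> norm ((2 * M + norm p) * K z)" for z
  proof -
    have "norm z * indicator (ball 0 1) z \<le> 1" by (auto simp: indicator_def)
    then have "norm p * (norm z * indicator (ball 0 1) z) \<le> norm p"
      by (metis mult_left_le norm_ge_zero)
    then have "\<bar>w (x + z) - w x - I_ind \<sigma> * indicator (ball 0 1) z * (p \<bullet> z)\<bar> \<le> 2 * M + norm p"
      using assms(2)[of x] assms(2)[of "x + z"] compensator_le[of z p] by linarith
    then show ?thesis
      using K_nonneg unfolding outer_integrand_def real_norm_def abs_mult
      by (intro mult_right_mono) auto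
  qed
  then show "AE z in lebesgue. z \<in> - ball 0 \<delta> \<longrightarrow> norm (outer_integrand w p x z) \<le> norm ((2 * M + norm p) * K z)"
    by auto
qed

text \<open>The slack \<open>E\<close> is what the doubling needs: there the increments are ordered
  only up to a multiple of \<open>\<theta>\<close>, because of the localizing penalty and of two
  slightly different gradients.\<close>

lemma nonlocal_outer_mono:
  assumes "w1 \<in> borel_measurable borel" "\<And>y. \<bar>w1 y\<bar> \<le> B1"
    and "w2 \<in> borel_measurable borel" "\<And>y. \<bar>w2 y\<bar> \<le> B2" "0 < \<delta>"
    and le: "\<And>z. \<delta> \<le> norm z \<Longrightarrow>
      w1 (x1 + z) - w1 x1 - I_ind \<sigma> * indicator (ball 0 1) z * (p1 \<bullet> z)
      \<le> w2 (x2 + z) - w2 x2 - I_ind \<sigma> * indicator (ball 0 1) z * (p2 \<bullet> z) + E"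
  shows "nonlocal_outer \<sigma> K \<delta> w1 p1 x1 \<le> nonlocal_outer \<sigma> K \<delta> w2 p2 x2 + E * tail \<delta>"
proof -
  have i1: "set_integrable lebesgue (- ball 0 \<delta>) (outer_integrand w1 p1 x1)"
    and i2: "set_integrable lebesgue (- ball 0 \<delta>) (outer_integrand w2 p2 x2)"
    and i3: "set_integrable lebesgue (- ball 0 \<delta>) (\<lambda>z. E * K z)"
    using assms by (auto intro!: outer_integrable set_integrable_mult_right K_integrable_outside)
  have "nonlocal_outer \<sigma> K \<delta> w1 p1 x1 \<le> (LINT z:- ball 0 \<delta>|lebesgue. outer_integrand w2 p2 x2 z + E * K z)"
    unfolding nonlocal_outer_alt
  proof (rule set_integral_mono[OF i1 set_integral_add(1)[OF i2 i3]])
    fix z :: 'a assume "z \<in> - ball 0 \<delta>"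
    then have "\<delta> \<le> norm z" by simp
    then show "outer_integrand w1 p1 x1 z \<le> outer_integrand w2 p2 x2 z + E * K z"
      unfolding outer_integrand_def distrib_right[symmetric]
      by (intro mult_right_mono le K_nonneg)
  qed
  also have "\<dots> = nonlocal_outer \<sigma> K \<delta> w2 p2 x2 + E * tail \<delta>"
    unfolding nonlocal_outer_alt tail_def using set_integral_add(2)[OF i2 i3] by simp
  finally show ?thesis .
qed

text \<open>Outside the unit ball only the bound \<open>M\<close> is used; on the annulus the
  increments are Hoelder and the compensator is weakened from \<open>|z|\<close> to
  \<open>|z|^(1 - b)\<close>. The exponent \<open>b\<close> is separate from \<open>\<beta>\<close>
  so that its loss can be balanced against the size of \<open>p\<close>.\<close>

lemma nonlocal_outer_bound:
  assumes "w \<in> borel_measurable borel" "\<And>y. \<bar>w y\<bar> \<le> M" "0 < \<delta>" "\<delta> < 1"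
    and hold: "\<And>z. \<bar>w (x + z) - w x\<bar> \<le> A * norm z powr (1 - \<beta>)"
    and "0 \<le> A" "0 < \<beta>" "0 < b"
  shows "\<bar>nonlocal_outer \<sigma> K \<delta> w p x\<bar> \<le> A * shell \<beta> \<delta> + 2 * M * tail 1 + norm p * shell b \<delta>"
proof -
  define S where "S = (ball 0 1 - ball 0 \<delta> :: 'a set)"
  have sh: "set_integrable lebesgue S (\<lambda>z. norm z powr (1 - c) * K z)" if "0 < c" for c
    using shell_bound[OF that] \<open>0 < \<delta>\<close> unfolding S_def by blast
  let ?g1 = "\<lambda>z. indicator S z * (A * (norm z powr (1 - \<beta>) * K z))"
  let ?g2 = "\<lambda>z. indicator (- ball 0 1) z * (2 * M * K z)"
  let ?g3 = "\<lambda>z. indicator S z * (norm p * (norm z powr (1 - b) * K z))"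
  have i1: "integrable lebesgue ?g1" and i3: "integrable lebesgue ?g3"
    using set_integrable_mult_right[OF sh[OF \<open>0 < \<beta>\<close>], of A] set_integrable_mult_right[OF sh[OF \<open>0 < b\<close>], of "norm p"]
    by (simp_all add: set_integrable_def)
  have i2: "integrable lebesgue ?g2"
    using set_integrable_mult_right[OF K_integrable_outside[of 1], of "2 * M"] by (simp add: set_integrable_def)
  have "M \<ge> 0" using assms(2)[of 0] by linarith
  have le: "norm (indicator (- ball 0 \<delta>) z *\<^sub>R outer_integrand w p x z) \<le> ?g1 z + ?g2 z + ?g3 z" for z
  proof -
    consider "norm z < \<delta>" | "\<delta> \<le> norm z" "norm z < 1" | "1 \<le> norm z" by linarith
    then show ?thesis
    proof cases
      case 1
      then show ?thesis using \<open>\<delta> < 1\<close> by (simp add: S_def)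
    next
      case 2
      have "norm z = norm z powr 1" by simp
      also have "\<dots> \<le> norm z powr (1 - b)"
        using 2 \<open>0 < b\<close> by (intro powr_mono') auto
      finally have "norm p * norm z \<le> norm p * norm z powr (1 - b)"
        by (rule mult_left_mono) simp
      then have "\<bar>w (x + z) - w x - I_ind \<sigma> * indicator (ball 0 1) z * (p \<bullet> z)\<bar>
          \<le> A * norm z powr (1 - \<beta>) + norm p * norm z powr (1 - b)"
        using hold[of z] compensator_le[of z p] 2 by simp
      then have "\<bar>w (x + z) - w x - I_ind \<sigma> * indicator (ball 0 1) z * (p \<bullet> z)\<bar> * K z
          \<le> (A * norm z powr (1 - \<beta>) + norm p * norm z powr (1 - b)) * K z"
        by (intro mult_right_mono K_nonneg)
      moreover have "norm (indicator (- ball 0 \<delta>) z *\<^sub>R outer_integrand w p x z)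
          = \<bar>w (x + z) - w x - I_ind \<sigma> * indicator (ball 0 1) z * (p \<bullet> z)\<bar> * K z"
        using 2 K_nonneg by (simp add: outer_integrand_def abs_mult)
      moreover have "?g1 z + ?g2 z + ?g3 z = (A * norm z powr (1 - \<beta>) + norm p * norm z powr (1 - b)) * K z"
        using 2 by (simp add: S_def algebra_simps)
      ultimately show ?thesis
        by (simp only:)
    next
      case 3
      have "\<bar>w (x + z) - w x\<bar> \<le> 2 * M" using assms(2)[of x] assms(2)[of "x + z"] by linarith
      then have "\<bar>w (x + z) - w x\<bar> * K z \<le> 2 * M * K z"
        by (intro mult_right_mono K_nonneg)
      then show ?thesis
        using 3 K_nonneg \<open>\<delta> < 1\<close> by (simp add: S_def outer_integrand_def abs_mult)
    qed
  qed
  have i0: "integrable lebesgue (\<lambda>z. indicator (- ball 0 \<delta>) z *\<^sub>R outer_integrand w p x z)"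
    using outer_integrable[OF assms(1,2,3)] by (simp add: set_integrable_def)
  have "\<bar>nonlocal_outer \<sigma> K \<delta> w p x\<bar> \<le> (\<integral>z. norm (indicator (- ball 0 \<delta>) z *\<^sub>R outer_integrand w p x z) \<partial>lebesgue)"
    unfolding nonlocal_outer_alt set_lebesgue_integral_def
    by (metis integral_norm_bound real_norm_def)
  also have "\<dots> \<le> (\<integral>z. ?g1 z + ?g2 z + ?g3 z \<partial>lebesgue)"
    by (intro integral_mono integrable_norm i0 Bochner_Integration.integrable_add i1 i2 i3 le)
  also have "\<dots> = (\<integral>z. ?g1 z \<partial>lebesgue) + (\<integral>z. ?g2 z \<partial>lebesgue) + (\<integral>z. ?g3 z \<partial>lebesgue)"
    using i1 i2 i3 by (simp only: Bochner_Integration.integral_add Bochner_Integration.integrable_add)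
  also have "(\<integral>z. ?g1 z \<partial>lebesgue) = A * shell \<beta> \<delta>"
    unfolding shell_def set_lebesgue_integral_def S_def
    by (subst integral_mult_right_zero[symmetric]) (simp add: mult_ac)
  also have "(\<integral>z. ?g2 z \<partial>lebesgue) = 2 * M * tail 1"
    unfolding tail_def set_lebesgue_integral_def
    by (subst integral_mult_right_zero[symmetric]) (simp add: mult_ac)
  also have "(\<integral>z. ?g3 z \<partial>lebesgue) = norm p * shell b \<delta>"
    unfolding shell_def set_lebesgue_integral_def S_def
    by (subst integral_mult_right_zero[symmetric]) (simp add: mult_ac)
  finally show ?thesis .
qed

end

section \<open>Space regularity of coercive subsolutions\<close>

text \<open>As a function of \<open>s^2\<close> the power \<open>s powr q\<close> is concave for
  \<open>q \<le> 2\<close>, so it lies below its tangent at \<open>r^2\<close>. Young's inequality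
  is that tangent inequality for positive bases.\<close>

lemma powr_le_tangent_quadratic:
  fixes r s q :: real
  assumes "0 < r" "0 \<le> s" "0 < q" "q \<le> 2"
  shows "s powr q \<le> r powr q + q / 2 * r powr (q - 2) * (s\<^sup>2 - r\<^sup>2)"
proof (cases "s = 0")
  case True
  have "r powr (q - 2) * r\<^sup>2 = r powr q"
    using assms by (simp add: powr_diff powr_numeral)
  then have "q / 2 * r powr (q - 2) * (s\<^sup>2 - r\<^sup>2) = - (q / 2 * r powr q)"
    using True by (simp add: algebra_simps)
  moreover have "q / 2 * r powr q \<le> 1 * r powr q"
    using assms by (intro mult_right_mono) auto
  moreover have "s powr q = 0" using True by simp
  ultimately show ?thesis by linarith
next
  case False
  then have s: "0 < s" using assms by simp
  have "(s\<^sup>2) powr (q / 2) * (r\<^sup>2) powr (1 - q / 2) \<le> q / 2 * s\<^sup>2 + (1 - q / 2) * r\<^sup>2"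
    using assms s by (intro Youngs_inequality_0) auto
  moreover have "(s\<^sup>2) powr (q / 2) = s powr q"
    using s by (simp add: powr_numeral[symmetric] powr_powr del: powr_numeral)
  moreover have "(r\<^sup>2) powr (1 - q / 2) = r powr (2 - q)"
    using assms by (simp add: powr_numeral[symmetric] powr_powr right_diff_distrib del: powr_numeral)
  ultimately have "s powr q * r powr (2 - q) \<le> q / 2 * s\<^sup>2 + (1 - q / 2) * r\<^sup>2"
    by simp
  then have "s powr q * r powr (2 - q) * r powr (q - 2) \<le> (q / 2 * s\<^sup>2 + (1 - q / 2) * r\<^sup>2) * r powr (q - 2)"
    by (intro mult_right_mono) auto
  moreover have "r powr (2 - q) * r powr (q - 2) = 1"
    using assms by (simp add: powr_add[symmetric])
  moreover have "r\<^sup>2 * r powr (q - 2) = r powr q"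
    using assms by (simp add: powr_diff powr_numeral)
  ultimately show ?thesis by (simp add: algebra_simps diff_divide_distrib)
qed

lemma usc_on_closed_domain_slice:
  assumes "usc_on (closed_parabolic_domain T) u" "s \<in> {0..T}"
  shows "usc_on UNIV (\<lambda>y. u (y, s))"
  by (rule usc_on_compose[OF assms(1)])
    (use assms(2) in \<open>auto intro!: continuous_intros simp: closed_parabolic_domain_def\<close>)

text \<open>The parameter \<open>a\<close> is a positive lower bound for the times \<open>t\<close> at which the sup-convolution
  in time is considered; \<open>2 * M < G * a\<^sup>2\<close> keeps its optimal times positive.\<close>

locale coercive_subsolution = small_order_kernel \<sigma> K Kb
  for \<sigma> :: real and K :: "'a::euclidean_space \<Rightarrow> real" and Kb :: real +
  fixes T M G a c C m' :: real and F :: "'a \<Rightarrow> 'a \<Rightarrow> real \<Rightarrow> real" and u :: "'a \<times> real \<Rightarrow> real"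
  assumes sub: "visc_subsolution T \<sigma> K F u"
    and u_le: "\<And>x t. t \<in> {0..T} \<Longrightarrow> \<bar>u (x, t)\<bar> \<le> M"
    and G_pos: "0 < G" and a_pos: "0 < a" and a_le: "a \<le> T" and shift: "2 * M < G * a\<^sup>2"
    and F_mono: "\<And>x p l1 l2. l2 \<le> l1 \<Longrightarrow> F x p l1 \<le> F x p l2"
    and m': "1 < m'" and C_pos: "0 < C" and c_pos: "0 < c"
    and coercive: "\<And>x p l. c * norm p powr m' - C * (\<bar>l\<bar> + 1) \<le> F x p l"
begin

definition U :: "'a \<Rightarrow> real \<Rightarrow> real" where
  "U x t = (SUP s\<in>{0..T}. u (x, s) - G * (s - t)\<^sup>2)"

lemma T_pos: "0 < T" using a_pos a_le by linarith

lemma M_nonneg: "0 \<le> M" using u_le[of 0 0] T_pos by (simp add: order_trans[OF abs_ge_zero])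

lemma u_usc: "usc_on (UNIV \<times> {0..T}) u"
  using sub by (simp add: visc_subsolution_def closed_parabolic_domain_def)

lemma u_penalized_usc: "usc_on (UNIV \<times> {0..T}) (\<lambda>z. u z - G * (snd z - t)\<^sup>2)"
  using usc_on_add[OF u_usc continuous_imp_usc_on[of "UNIV \<times> {0..T}" "\<lambda>z. - (G * (snd z - t)\<^sup>2)"]]
  by (simp add: continuous_intros)

lemma U_attained: "\<exists>s\<in>{0..T}. U x t = u (x, s) - G * (s - t)\<^sup>2"
  and U_ge: "s \<in> {0..T} \<Longrightarrow> u (x, s) - G * (s - t)\<^sup>2 \<le> U x t"
  and U_measurable: "(\<lambda>x. U x t) \<in> borel_measurable borel"
proof -
  have ne: "compact {0..T}" "{0..T} \<noteq> {}" using T_pos by auto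
  note S = usc_on_SUP[OF ne u_penalized_usc[of t], simplified]
  show "\<exists>s\<in>{0..T}. U x t = u (x, s) - G * (s - t)\<^sup>2"
    using S(1)[of x] unfolding U_def by auto
  show "s \<in> {0..T} \<Longrightarrow> u (x, s) - G * (s - t)\<^sup>2 \<le> U x t"
    using S(1)[of x] unfolding U_def by auto
  show "(\<lambda>x. U x t) \<in> borel_measurable borel"
    unfolding U_def using S(2) by (rule usc_on_UNIV_borel_measurable)
qed

lemma U_bound:
  assumes "t \<in> {0..T}"
  shows "\<bar>U x t\<bar> \<le> M"
proof -
  obtain s where s: "s \<in> {0..T}" "U x t = u (x, s) - G * (s - t)\<^sup>2" using U_attained by blast
  have "0 \<le> G * (s - t)\<^sup>2" using G_pos by simp
  then have "U x t \<le> M" using s u_le[of s x] by linarith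
  moreover have "- M \<le> U x t" using U_ge[OF assms, of x t] u_le[OF assms, of x] by simp
  ultimately show ?thesis by simp
qed

text \<open>Choosing time \<open>0\<close> would cost at least \<open>G * a^2\<close>, more than the
  oscillation \<open>2 * M\<close> can repay. Positivity puts the optimal point into the domain
  where the viscosity inequality holds.\<close>

lemma U_optimal_time_pos:
  assumes "t \<in> {a..T}" "s \<in> {0..T}" "U x t = u (x, s) - G * (s - t)\<^sup>2"
  shows "0 < s"
proof (rule ccontr)
  assume "\<not> 0 < s"
  then have "s = 0" using assms by simp
  then have "G * t\<^sup>2 = u (x, s) - U x t" using assms(3) by simp
  also have "\<dots> \<le> 2 * M"
    using u_le[OF assms(2), of x] U_bound[of t x] assms(1) a_pos by auto
  also have "\<dots> < G * a\<^sup>2" by (rule shift)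
  also have "\<dots> \<le> G * t\<^sup>2"
    using assms(1) a_pos G_pos by (intro mult_left_mono power_mono) auto
  finally show False by simp
qed

text \<open>Adding \<open>G * (\<tau> - t)^2\<close> to a space function touching \<open>U\<close>
  from above yields a space-time function touching \<open>u\<close> at the optimal time. The time
  derivative is then explicit, and bounded on \<open>[0, T]\<close>.\<close>

lemma U_subsolution:
  assumes "t \<in> {a..T}" "s \<in> {0..T}" "U x t = u (x, s) - G * (s - t)\<^sup>2" "0 < \<delta>" "\<delta> < 1"
    and max: "\<And>y. U y t - (\<kappa> * (y \<bullet> y) + b \<bullet> y) \<le> U x t - (\<kappa> * (x \<bullet> x) + b \<bullet> x)"
    and p: "p = (2 * \<kappa>) *\<^sub>R x + b"
  shows "2 * G * (s - t) + F x p (\<kappa> * M2 \<delta> + drift \<delta> p + nonlocal_outer \<sigma> K \<delta> (\<lambda>y. U y t) p x) \<le> 0"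
proof -
  have s: "0 < s" "s \<le> T" using U_optimal_time_pos assms(1-3) by auto
  have t: "t \<in> {0..T}" using assms(1) a_pos by auto
  \<comment> \<open>In time this is \<open>G * (\<tau> - t)^2\<close> without its constant
    \<open>G * t^2\<close>.\<close>
  let ?\<phi> = "quad \<kappa> b G (- 2 * G * t)"
  have touch: "u (y, \<tau>) - ?\<phi> (y, \<tau>) \<le> u (x, s) - ?\<phi> (x, s)" if "\<tau> \<in> {0..T}" for y \<tau>
  proof -
    have eq: "u (y, \<tau>) - ?\<phi> (y, \<tau>) = (u (y, \<tau>) - G * (\<tau> - t)\<^sup>2) - (\<kappa> * (y \<bullet> y) + b \<bullet> y) + G * t\<^sup>2" for y \<tau>
      by (simp add: quad_def power2_eq_square algebra_simps)
    show ?thesis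
      unfolding eq using max[of y] U_ge[OF that, of y t] assms(3) by linarith
  qed
  have "visc_lhs T \<sigma> K F \<delta> u ?\<phi> x s \<le> 0"
  proof -
    have "\<forall>(y, \<tau>)\<in>(ball x \<delta> \<times> {s - \<delta><..<s + \<delta>}) \<inter> parabolic_domain T.
        u (y, \<tau>) - ?\<phi> (y, \<tau>) \<le> u (x, s) - ?\<phi> (x, s)"
      using touch by (auto simp: parabolic_domain_def)
    moreover have "(x, s) \<in> parabolic_domain T" using s by (simp add: parabolic_domain_def)
    ultimately show ?thesis
      using sub C2_on_quad assms(4,5) unfolding visc_subsolution_def by blast
  qed
  then have 1: "2 * G * s - 2 * G * t + F x p (\<kappa> * M2 \<delta> + drift \<delta> p + nonlocal_outer \<sigma> K \<delta> (\<lambda>y. u (y, s)) p x) \<le> 0"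
    unfolding visc_lhs_quad[OF assms(4,5) s] p[symmetric] by simp
  \<comment> \<open>The time \<open>s\<close>, optimal at \<open>x\<close>, is a competitor at
    \<open>x + z\<close> with the same penalty; hence increments of \<open>u\<close> at time
    \<open>s\<close> lie below increments of \<open>U\<close> at time \<open>t\<close>.\<close>
  have "nonlocal_outer \<sigma> K \<delta> (\<lambda>y. u (y, s)) p x \<le> nonlocal_outer \<sigma> K \<delta> (\<lambda>y. U y t) p x + 0 * tail \<delta>"
  proof (rule nonlocal_outer_mono[where ?B1.0 = M and ?B2.0 = M])
    show "(\<lambda>y. u (y, s)) \<in> borel_measurable borel"
      using sub assms(2) unfolding visc_subsolution_def
      by (intro usc_on_UNIV_borel_measurable usc_on_closed_domain_slice[of T]) auto
    show "\<bar>u (y, s)\<bar> \<le> M" for y using u_le assms(2) by simp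
    show "\<bar>U y t\<bar> \<le> M" for y using U_bound t by simp
    show "u (x + z, s) - u (x, s) - I_ind \<sigma> * indicator (ball 0 1) z * (p \<bullet> z)
      \<le> U (x + z) t - U x t - I_ind \<sigma> * indicator (ball 0 1) z * (p \<bullet> z) + 0" for z
      using U_ge[OF assms(2), of "x + z" t] assms(3) by simp
  qed (use U_measurable assms in auto)
  then have "F x p (\<kappa> * M2 \<delta> + drift \<delta> p + nonlocal_outer \<sigma> K \<delta> (\<lambda>y. U y t) p x)
      \<le> F x p (\<kappa> * M2 \<delta> + drift \<delta> p + nonlocal_outer \<sigma> K \<delta> (\<lambda>y. u (y, s)) p x)"
    by (intro F_mono) simp
  then show ?thesis using 1 by (simp add: right_diff_distrib)
qed

text \<open>Indexed by the defect from Lipschitz continuity, because one regularity step divides the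
  defect by \<open>m'\<close>. The inequality is one-sided, as \<open>x\<close> and \<open>y\<close>
  may be exchanged, and the constant is uniform over \<open>[a, T]\<close>.\<close>

definition holder :: "real \<Rightarrow> bool" where
  "holder \<beta> \<longleftrightarrow> (\<exists>A\<ge>0. \<forall>t\<in>{a..T}. \<forall>x y. U y t - U x t \<le> A * norm (y - x) powr (1 - \<beta>))"

lemma holder_abs:
  assumes "\<forall>t\<in>{a..T}. \<forall>x y. U y t - U x t \<le> A * norm (y - x) powr (1 - \<beta>)" "t \<in> {a..T}"
  shows "\<bar>U (x + z) t - U x t\<bar> \<le> A * norm z powr (1 - \<beta>)"
  using assms(1)[rule_format, OF assms(2), of "x + z" x] assms(1)[rule_format, OF assms(2), of x "x + z"]
  by (simp add: abs_le_iff)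

lemma holder_one: "holder 1"
  unfolding holder_def
proof (intro exI[of _ "2 * M"] conjI ballI allI)
  show "0 \<le> 2 * M" using M_nonneg by simp
  fix t x y assume "t \<in> {a..T}"
  then have "t \<in> {0..T}" using a_pos by auto
  \<comment> \<open>The case \<open>y = x\<close> is separate because
    \<open>0 powr 0 = 0\<close>.\<close>
  then show "U y t - U x t \<le> 2 * M * norm (y - x) powr (1 - 1)"
    using U_bound[of t x] U_bound[of t y] by (cases "y = x") auto
qed

text \<open>At distance one or more from \<open>x0\<close> the penalty is at least
  \<open>L > 2 * M\<close>, so such points are worse than \<open>x0\<close> and the maximum over the
  unit ball is global. The violation at \<open>y1\<close> keeps the maximum away from
  \<open>x0\<close>, so that the tangent quadratic is available there.\<close>

lemma max_against_powr:
  assumes t: "t \<in> {a..T}" and L: "2 * M < L" and \<alpha>: "0 < \<alpha>"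
    and viol: "U y1 t - U x0 t > L * norm (y1 - x0) powr \<alpha>"
  obtains y s where "s \<in> {0..T}" "U y t = u (y, s) - G * (s - t)\<^sup>2" "0 < norm (y - x0)" "norm (y - x0) < 1"
    "\<And>y'. U y' t - L * norm (y' - x0) powr \<alpha> \<le> U y t - L * norm (y - x0) powr \<alpha>"
proof -
  have t0: "t \<in> {0..T}" using t a_pos by auto
  have L0: "0 < L" using L M_nonneg by simp
  define f where "f z = (u z - G * (snd z - t)\<^sup>2) + (- (L * norm (fst z - x0) powr \<alpha>))" for z
  have "continuous_on UNIV (\<lambda>z::'a \<times> real. norm (fst z - x0) powr \<alpha>)"
    using \<alpha> by (intro continuous_on_powr' continuous_intros) auto
  then have "continuous_on (UNIV \<times> {0..T}) (\<lambda>z::'a \<times> real. - (L * norm (fst z - x0) powr \<alpha>))"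
    by (intro continuous_on_minus continuous_on_mult_left) (erule continuous_on_subset, simp)
  then have "usc_on (UNIV \<times> {0..T}) f"
    unfolding f_def by (intro usc_on_add u_penalized_usc continuous_imp_usc_on)
  then have "usc_on (cball x0 1 \<times> {0..T}) f"
    by (rule usc_on_compose[where g = "\<lambda>z. z"]) auto
  then obtain z where z: "z \<in> cball x0 1 \<times> {0..T}" "\<forall>z'\<in>cball x0 1 \<times> {0..T}. f z' \<le> f z"
    using usc_on_attains_sup[of "cball x0 1 \<times> {0..T}" f] T_pos by (auto simp: compact_Times)
  obtain y s where ys: "z = (y, s)" by (cases z)
  have s: "s \<in> {0..T}" using z ys by auto
  have max: "f (y', s') \<le> f (y, s)" if s': "s' \<in> {0..T}" for y' s'
  proof (cases "y' \<in> cball x0 1")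
    case True
    then show ?thesis using z s' ys by auto
  next
    case False
    then have "1 \<le> norm (y' - x0)" by (simp add: dist_norm norm_minus_commute)
    then have "1 \<le> norm (y' - x0) powr \<alpha>" using \<alpha> by (intro ge_one_powr_ge_zero) auto
    then have "L * 1 \<le> L * norm (y' - x0) powr \<alpha>" using L0 by (intro mult_left_mono) auto
    moreover have "0 \<le> G * (s' - t)\<^sup>2" using G_pos by simp
    ultimately have "f (y', s') \<le> M - L"
      unfolding f_def using u_le[OF s', of y'] by simp
    also have "\<dots> \<le> - M" using L by simp
    also have "\<dots> \<le> f (x0, t)" unfolding f_def using u_le[OF t0, of x0] by simp
    also have "\<dots> \<le> f (y, s)" using z ys t0 by auto
    finally show ?thesis .
  qed
  have Umax: "U y' t - L * norm (y' - x0) powr \<alpha> \<le> f (y, s)" for y'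
  proof -
    obtain s' where "s' \<in> {0..T}" "U y' t = u (y', s') - G * (s' - t)\<^sup>2" using U_attained by blast
    then show ?thesis using max[of s' y'] by (simp add: f_def)
  qed
  have Uy: "U y t = u (y, s) - G * (s - t)\<^sup>2"
    using Umax[of y] U_ge[OF s, of y t] by (simp add: f_def)
  have fU: "f (y, s) = U y t - L * norm (y - x0) powr \<alpha>"
    unfolding f_def Uy by simp
  have gt: "L * norm (y - x0) powr \<alpha> < U y t - U x0 t"
    using Umax[of y1] viol unfolding fU by linarith
  then have "y \<noteq> x0" by auto
  have "L * norm (y - x0) powr \<alpha> < L * 1"
    using gt U_bound[OF t0, of y] U_bound[OF t0, of x0] L by linarith
  then have "norm (y - x0) powr \<alpha> < 1" using L0 by (simp add: mult_less_cancel_left)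
  then have "norm (y - x0) < 1"
    using \<alpha> ge_one_powr_ge_zero[of "norm (y - x0)" \<alpha>] by linarith
  with that[OF s Uy] \<open>y \<noteq> x0\<close> Umax show ?thesis unfolding fU by simp
qed

text \<open>At a touching point at distance \<open>r\<close> from \<open>x0\<close> the gradient has
  size \<open>L * \<alpha> * r^(\<alpha> - 1)\<close>. The exponent \<open>\<alpha>\<close> is the
  one for which \<open>|p|^m'\<close> scales like \<open>r^(-\<beta>)\<close>, as the nonlocal term
  does. The powers of \<open>r\<close> then cancel and \<open>L^m'\<close> is bounded by a multiple
  of \<open>L\<close>, which fails for large \<open>L\<close>.\<close>

lemma holder_step:
  assumes h: "holder \<beta>" and \<beta>: "0 < \<beta>" "\<beta> \<le> 1"
  shows "holder (\<beta> / m')"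
proof -
  obtain A where A: "A \<ge> 0" "\<forall>t\<in>{a..T}. \<forall>x y. U y t - U x t \<le> A * norm (y - x) powr (1 - \<beta>)"
    using h unfolding holder_def by blast
  define \<alpha> where "\<alpha> = 1 - \<beta> / m'"
  \<comment> \<open>Loss allowed to the compensator: \<open>(\<alpha> - 1) - b = - \<beta>\<close>,
    so gradient times shell integral again scales like \<open>r^(-\<beta>)\<close>.\<close>
  define b where "b = \<beta> - \<beta> / m'"
  have bm: "0 < \<beta> / m'" "\<beta> / m' < \<beta>" using \<beta> m' by (simp_all add: field_simps)
  then have \<alpha>: "0 < \<alpha>" "\<alpha> \<le> 1" and b: "0 < b" using \<beta> by (simp_all add: \<alpha>_def b_def)
  obtain C2 where C2: "C2 \<ge> 0" "\<And>\<delta>. 0 < \<delta> \<Longrightarrow> \<delta> \<le> 1 \<Longrightarrow> M2 \<delta> \<le> C2 * \<delta>" using M2_bound by blast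
  obtain C4 where C4: "C4 \<ge> 0" "\<And>\<delta> p. 0 < \<delta> \<Longrightarrow> \<delta> \<le> 1 \<Longrightarrow> \<bar>drift \<delta> p\<bar> \<le> C4 * norm p"
    using drift_bound by blast
  obtain S1 where S1: "S1 \<ge> 0" "\<And>\<delta>. 0 < \<delta> \<Longrightarrow> shell \<beta> \<delta> \<le> S1 * \<delta> powr - \<beta>"
    using shell_bound[OF \<beta>(1)] by blast
  obtain S2 where S2: "S2 \<ge> 0" "\<And>\<delta>. 0 < \<delta> \<Longrightarrow> shell b \<delta> \<le> S2 * \<delta> powr - b"
    using shell_bound[OF b] by blast
  \<comment> \<open>\<open>D\<close> is the constant in \<open>|l| \<le> D * (L * \<rho>)\<close>
    with \<open>\<rho> = r powr - \<beta>\<close>. \<open>E\<close> adds the coercivity constant and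
    the time derivative, which is at most \<open>2 * G * T\<close>.\<close>
  define D where "D = C2 + C4 + S2 + A * S1 + 2 * M * tail 1"
  define E where "E = C * (D + 1) + 2 * G * T"
  have D: "0 \<le> D" unfolding D_def
    using C2 C4 S1 S2 A M_nonneg tail_nonneg by (intro add_nonneg_nonneg mult_nonneg_nonneg) auto
  have E: "0 \<le> E" unfolding E_def
    using D C_pos G_pos T_pos by (intro add_nonneg_nonneg mult_nonneg_nonneg) auto
  \<comment> \<open>The extra \<open>1\<close> makes the final inequality strict. In
    \<open>L\<close>, the summand \<open>1 + 2 * M\<close> serves \<open>max_against_powr\<close>
    and the power of \<open>q\<close> beats \<open>E\<close>; neither depends on \<open>t\<close>,
    \<open>x0\<close> or \<open>y1\<close>.\<close>
  define q where "q = E / (c * \<alpha> powr m') + 1"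
  have q: "1 \<le> q" using E c_pos by (simp add: q_def)
  define L where "L = 1 + 2 * M + q powr (1 / (m' - 1))"
  have L: "1 \<le> L" "2 * M < L" using M_nonneg by (simp_all add: L_def add_pos_nonneg)
  have "q = (q powr (1 / (m' - 1))) powr (m' - 1)" using q m' by (simp add: powr_powr)
  also have "\<dots> \<le> L powr (m' - 1)" using m' M_nonneg by (intro powr_mono2) (auto simp: L_def)
  finally have "E / (c * \<alpha> powr m') < L powr (m' - 1)" by (simp add: q_def)
  then have LE: "E < c * \<alpha> powr m' * L powr (m' - 1)"
    using c_pos \<alpha> by (simp add: field_simps)
  have main: "U y1 t - U x0 t \<le> L * norm (y1 - x0) powr \<alpha>" if t: "t \<in> {a..T}" for t x0 y1
  proof (rule ccontr)
    assume "\<not> ?thesis"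
    then have viol: "U y1 t - U x0 t > L * norm (y1 - x0) powr \<alpha>" by simp
    obtain y s where ys: "s \<in> {0..T}" "U y t = u (y, s) - G * (s - t)\<^sup>2"
      and r0: "0 < norm (y - x0)" and r1: "norm (y - x0) < 1"
      and max: "\<And>y'. U y' t - L * norm (y' - x0) powr \<alpha> \<le> U y t - L * norm (y - x0) powr \<alpha>"
      using max_against_powr[OF t L(2) \<alpha>(1) viol] by metis
    define r where "r = norm (y - x0)"
    note r0 = r0[folded r_def] and r1 = r1[folded r_def]
    \<comment> \<open>Slope of the tangent to \<open>L * s powr \<alpha>\<close> as a function of
      \<open>s^2\<close>, taken at \<open>s = r\<close>. The resulting quadratic touches at the same
      maximum point.\<close>
    define \<kappa> where "\<kappa> = L * (\<alpha> / 2 * r powr (\<alpha> - 2))"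
    have \<kappa>: "0 \<le> \<kappa>" using L \<alpha> by (simp add: \<kappa>_def)
    define p where "p = (2 * \<kappa>) *\<^sub>R y + (- (2 * \<kappa>)) *\<^sub>R x0"
    have max': "U y' t - (\<kappa> * (y' \<bullet> y') + ((- (2 * \<kappa>)) *\<^sub>R x0) \<bullet> y')
        \<le> U y t - (\<kappa> * (y \<bullet> y) + ((- (2 * \<kappa>)) *\<^sub>R x0) \<bullet> y)" for y'
    proof -
      have "L * norm (y' - x0) powr \<alpha> \<le> L * (r powr \<alpha> + \<alpha> / 2 * r powr (\<alpha> - 2) * ((norm (y' - x0))\<^sup>2 - r\<^sup>2))"
        using r0 \<alpha> L by (intro mult_left_mono powr_le_tangent_quadratic) auto
      also have "\<dots> = L * r powr \<alpha> + \<kappa> * ((norm (y' - x0))\<^sup>2 - r\<^sup>2)"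
        by (simp only: \<kappa>_def distrib_left mult.assoc)
      finally have 1: "L * norm (y' - x0) powr \<alpha> \<le> L * r powr \<alpha> + \<kappa> * ((norm (y' - x0))\<^sup>2 - r\<^sup>2)" .
      have sq: "\<kappa> * (norm (v - x0))\<^sup>2 = (\<kappa> * (v \<bullet> v) + ((- (2 * \<kappa>)) *\<^sub>R x0) \<bullet> v) + \<kappa> * (x0 \<bullet> x0)" for v
        by (simp add: power2_norm_eq_inner inner_diff_left inner_diff_right inner_commute algebra_simps)
      show ?thesis
        using max[of y'] 1 sq[of y'] sq[of y] unfolding r_def right_diff_distrib by linarith
    qed
    \<comment> \<open>The operator is split at radius \<open>r\<close>, the distance to
      \<open>x0\<close>, so that the curvature term \<open>\<kappa> * M2 r\<close> is controlled by
      the gradient.\<close>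
    define l where "l = \<kappa> * M2 r + drift r p + nonlocal_outer \<sigma> K r (\<lambda>y. U y t) p y"
    have sub: "2 * G * (s - t) + F y p l \<le> 0"
      unfolding l_def by (rule U_subsolution[OF t ys r0 r1 max' p_def])
    have "p = (2 * \<kappa>) *\<^sub>R (y - x0)" by (simp add: p_def scaleR_diff_right)
    then have "norm p = 2 * \<kappa> * r" using \<kappa> by (simp add: r_def)
    also have "\<dots> = L * \<alpha> * (r powr (\<alpha> - 2) * r)" by (simp add: \<kappa>_def)
    also have "r powr (\<alpha> - 2) * r = r powr (\<alpha> - 1)"
      using r0 by (simp add: powr_diff powr_numeral field_simps power2_eq_square)
    finally have np: "norm p = L * \<alpha> * r powr (\<alpha> - 1)" .
    define \<rho> where "\<rho> = r powr - \<beta>"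
    have \<rho>1: "1 \<le> \<rho>" unfolding \<rho>_def using r0 r1 \<beta> powr_mono'[of "- \<beta>" 0 r] by simp
    have ra: "r powr (\<alpha> - 1) \<le> \<rho>"
      unfolding \<rho>_def \<alpha>_def using r0 r1 bm by (intro powr_mono') auto
    have rb: "r powr (\<alpha> - 1) * r powr - b = \<rho>"
      unfolding \<rho>_def powr_add[symmetric] by (simp add: \<alpha>_def b_def)
    have L\<alpha>: "L * \<alpha> \<le> L" "0 \<le> L * \<alpha>" using L \<alpha> by (simp_all add: mult_left_le)
    have np_le: "norm p \<le> L * \<rho>" unfolding np using L\<alpha> ra L by (intro mult_mono) auto
    have b1: "\<bar>\<kappa> * M2 r\<bar> \<le> C2 * (L * \<rho>)"
    proof -
      have "\<bar>\<kappa> * M2 r\<bar> = \<kappa> * M2 r" using \<kappa> M2_nonneg by simp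
      also have "\<dots> \<le> \<kappa> * (C2 * r)" using C2(2)[of r] r0 r1 \<kappa> by (intro mult_left_mono) auto
      also have "\<dots> = C2 * (norm p / 2)" using \<open>norm p = 2 * \<kappa> * r\<close> by simp
      also have "\<dots> \<le> C2 * (L * \<rho>)" using np_le C2 norm_ge_zero[of p] by (intro mult_left_mono) linarith+
      finally show ?thesis .
    qed
    have b2: "\<bar>drift r p\<bar> \<le> C4 * (L * \<rho>)"
      using C4(2)[of r p] r0 r1 mult_left_mono[OF np_le C4(1)] by linarith
    have b3: "\<bar>nonlocal_outer \<sigma> K r (\<lambda>y. U y t) p y\<bar> \<le> L * \<rho> * (A * S1) + L * \<rho> * (2 * M * tail 1) + S2 * (L * \<rho>)"
    proof -
      have "\<bar>nonlocal_outer \<sigma> K r (\<lambda>y. U y t) p y\<bar> \<le> A * shell \<beta> r + 2 * M * tail 1 + norm p * shell b r"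
        using t a_pos by (intro nonlocal_outer_bound U_measurable U_bound holder_abs[OF A(2)] A \<beta> b r0 r1) auto
      moreover have "A * shell \<beta> r \<le> A * (S1 * \<rho>)"
        using S1(2)[OF r0] A unfolding \<rho>_def by (intro mult_left_mono) auto
      moreover have "1 * (A * S1 * \<rho>) \<le> L * (A * S1 * \<rho>)"
        using L A S1 \<rho>1 by (intro mult_right_mono mult_nonneg_nonneg) auto
      moreover have "1 * (2 * M * tail 1) \<le> L * \<rho> * (2 * M * tail 1)"
        using L \<rho>1 M_nonneg tail_nonneg mult_mono[of 1 L 1 \<rho>] by (intro mult_right_mono) auto
      moreover have "norm p * shell b r \<le> S2 * (L * \<rho>)"
      proof -
        have "norm p * shell b r \<le> norm p * (S2 * r powr - b)"
          using S2(2)[OF r0] by (intro mult_left_mono) auto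
        also have "\<dots> = L * \<alpha> * (S2 * \<rho>)" unfolding np rb[symmetric] by simp
        also have "\<dots> \<le> L * (S2 * \<rho>)" using L\<alpha> S2 \<rho>1 by (intro mult_right_mono) auto
        finally show ?thesis by (simp add: mult_ac)
      qed
      ultimately show ?thesis by (simp add: mult_ac)
    qed
    have "\<bar>l\<bar> \<le> \<bar>\<kappa> * M2 r\<bar> + \<bar>drift r p\<bar> + \<bar>nonlocal_outer \<sigma> K r (\<lambda>y. U y t) p y\<bar>"
      unfolding l_def by linarith
    also have "\<dots> \<le> D * (L * \<rho>)"
      using b1 b2 b3 unfolding D_def by (simp add: algebra_simps)
    finally have l: "\<bar>l\<bar> \<le> D * (L * \<rho>)" .
    have L\<rho>: "1 \<le> L * \<rho>" using L \<rho>1 mult_mono[of 1 L 1 \<rho>] by simp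
    have "norm p powr m' = (L * \<alpha>) powr m' * (r powr (\<alpha> - 1)) powr m'"
      unfolding np using L\<alpha> by (simp add: powr_mult)
    also have "(r powr (\<alpha> - 1)) powr m' = \<rho>"
      unfolding \<rho>_def powr_powr using m' by (simp add: \<alpha>_def)
    finally have pm: "norm p powr m' = L powr m' * \<alpha> powr m' * \<rho>"
      using L \<alpha> by (simp add: powr_mult)
    have "2 * G * (t - s) \<le> 2 * G * T"
      using t ys(1) G_pos by (intro mult_left_mono) auto
    then have "c * norm p powr m' \<le> C * (\<bar>l\<bar> + 1) + 2 * G * T"
      using sub coercive[of p l y] by (simp add: right_diff_distrib)
    also have "\<dots> \<le> C * (D * (L * \<rho>) + L * \<rho>) + 2 * G * T * (L * \<rho>)"
      using l L\<rho> C_pos G_pos T_pos mult_left_mono[OF L\<rho>, of "2 * G * T"]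
      by (intro add_mono mult_left_mono) auto
    also have "\<dots> = E * (L * \<rho>)" by (simp add: E_def algebra_simps)
    finally have "c * (L powr m' * \<alpha> powr m' * \<rho>) \<le> E * (L * \<rho>)" unfolding pm .
    moreover have "L powr m' = L * L powr (m' - 1)" using L by (simp add: powr_diff)
    ultimately have "(c * \<alpha> powr m' * L powr (m' - 1)) * (L * \<rho>) \<le> E * (L * \<rho>)"
      by (simp add: mult_ac)
    then have "c * \<alpha> powr m' * L powr (m' - 1) \<le> E"
      using L\<rho> by (simp add: mult_le_cancel_right)
    then show False using LE by simp
  qed
  show ?thesis
    unfolding holder_def using main L unfolding \<alpha>_def by (intro exI[of _ L]) auto
qed

lemma holder_small:
  assumes "0 < \<beta>0"
  obtains \<beta> where "0 < \<beta>" "\<beta> \<le> \<beta>0" "\<beta> \<le> 1" "holder \<beta>"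
proof -
  have P: "0 < (1 / m') ^ k \<and> (1 / m') ^ k \<le> 1 \<and> holder ((1 / m') ^ k)" for k
  proof (induction k)
    case 0
    then show ?case using holder_one by simp
  next
    case (Suc k)
    have "(1 / m') ^ Suc k \<le> 1" using m' by (intro power_le_one) auto
    then show ?case using holder_step[of "(1 / m') ^ k"] Suc m' by simp
  qed
  obtain k where "(1 / m') ^ k < \<beta>0"
    using real_arch_pow_inv[OF assms, of "1 / m'"] m' by auto
  then show ?thesis using that[of "(1 / m') ^ k"] P[of k] by simp
qed

end

section \<open>Doubling of variables\<close>

lemma modulus_of_continuity_add:
  assumes "modulus_of_continuity \<omega>1" "modulus_of_continuity \<omega>2"
  shows "modulus_of_continuity (\<lambda>t. \<omega>1 t + \<omega>2 t)"
proof -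
  have "mono_on {0..} (\<lambda>t. \<omega>1 t + \<omega>2 t)"
    using assms by (auto simp: modulus_of_continuity_def mono_on_def intro!: add_mono)
  moreover have "((\<lambda>t. \<omega>1 t + \<omega>2 t) \<longlongrightarrow> 0 + 0) (at_right 0)"
    using assms by (intro tendsto_add) (simp_all add: modulus_of_continuity_def)
  ultimately show ?thesis
    using assms by (simp add: modulus_of_continuity_def)
qed

lemma modulus_of_continuity_small:
  assumes "modulus_of_continuity \<omega>" "0 < e"
  obtains r where "0 < r" "\<And>t. 0 \<le> t \<Longrightarrow> t < r \<Longrightarrow> \<omega> t < e"
proof -
  have "(\<omega> \<longlongrightarrow> 0) (at_right 0)" using assms by (simp add: modulus_of_continuity_def)
  then have "\<forall>\<^sub>F t in at_right 0. \<omega> t < e" using assms(2) by (rule order_tendstoD)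
  then obtain r where r: "0 < r" "\<And>t. 0 < t \<Longrightarrow> t < r \<Longrightarrow> \<omega> t < e"
    unfolding eventually_at_right_field by auto
  have "\<omega> t < e" if "0 \<le> t" "t < r" for t
    using r(2)[of t] that assms by (cases "t = 0") (auto simp: modulus_of_continuity_def)
  then show ?thesis using that r(1) by blast
qed

text \<open>Being at most one, it changes nonlocal increments by at most \<open>\<theta>\<close>
  after multiplication by \<open>\<theta>\<close>. Being below \<open>|z|^2\<close> with equality in
  the unit ball, it can be replaced by that smooth quadratic when a test function is needed.\<close>

definition cap :: "'a::real_normed_vector \<Rightarrow> real" where
  "cap z = min 1 ((norm z)\<^sup>2)"

lemma cap_bounds: "0 \<le> cap z" "cap z \<le> 1" "cap z \<le> (norm z)\<^sup>2"
  by (simp_all add: cap_def)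

lemma cap_inside: "norm z < 1 \<Longrightarrow> cap z = (norm z)\<^sup>2"
  by (simp add: cap_def power_le_one)

lemma cap_outside: "1 \<le> norm z \<Longrightarrow> cap z = 1"
  by (simp add: cap_def one_le_power)

context coercive_subsolution
begin

text \<open>The term \<open>\<eta> * s\<close> makes the supersolution inequality strict. It acts on
  the time of \<open>v\<close>, so maximizing over \<open>\<tau>\<close> leaves exactly
  \<open>U x s\<close>.\<close>

definition doubled :: "('a \<times> real \<Rightarrow> real) \<Rightarrow> real \<Rightarrow> real \<Rightarrow> 'a \<Rightarrow> 'a \<Rightarrow> real \<Rightarrow> real \<Rightarrow> real" where
  "doubled v H \<eta> x y \<tau> s = u (x, \<tau>) - v (y, s) - H * (norm (x - y))\<^sup>2 - G * (\<tau> - s)\<^sup>2 - \<eta> * s"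

lemma doubled_usc:
  assumes "lsc_on (closed_parabolic_domain T) v"
  shows "usc_on (UNIV \<times> UNIV \<times> {0..T} \<times> {0..T})
    (\<lambda>(x, y, \<tau>, s). doubled v H \<eta> x y \<tau> s - \<theta> * cap (x - x1))"
proof -
  let ?D = "UNIV \<times> UNIV \<times> {0..T} \<times> {0..T} :: ('a \<times> 'a \<times> real \<times> real) set"
  have 1: "usc_on ?D (\<lambda>z. u (fst z, fst (snd (snd z))))"
    by (rule usc_on_compose[OF u_usc]) (auto intro!: continuous_intros)
  have 2: "usc_on ?D (\<lambda>z. - v (fst (snd z), snd (snd (snd z))))"
    by (rule usc_on_compose[OF usc_on_uminus[OF assms]])
      (auto intro!: continuous_intros simp: closed_parabolic_domain_def)
  have 3: "usc_on ?D (\<lambda>z. - H * (norm (fst z - fst (snd z)))\<^sup>2 - G * (fst (snd (snd z)) - snd (snd (snd z)))\<^sup>2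
      - \<eta> * snd (snd (snd z)) - \<theta> * cap (fst z - x1))"
    unfolding cap_def by (intro continuous_imp_usc_on continuous_intros)
  have eq: "(\<lambda>(x, y, \<tau>, s). doubled v H \<eta> x y \<tau> s - \<theta> * cap (x - x1))
    = (\<lambda>z. u (fst z, fst (snd (snd z))) + - v (fst (snd z), snd (snd (snd z))) +
      (- H * (norm (fst z - fst (snd z)))\<^sup>2 - G * (fst (snd (snd z)) - snd (snd (snd z)))\<^sup>2
        - \<eta> * snd (snd (snd z)) - \<theta> * cap (fst z - x1)))"
    by (auto simp: fun_eq_iff doubled_def)
  show ?thesis
    unfolding eq by (rule usc_on_add[OF usc_on_add[OF 1 2] 3])
qed

text \<open>A bounded penalty centred at an almost maximal point makes the supremum attained; its size
  \<open>\<theta>\<close> can be chosen after all other parameters.\<close>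

lemma doubled_max:
  assumes v: "lsc_on (closed_parabolic_domain T) v" "\<And>x t. t \<in> {0..T} \<Longrightarrow> \<bar>v (x, t)\<bar> \<le> M"
    and pos: "0 < H" "0 < \<theta>" "0 \<le> \<eta>"
    and S: "t0 \<in> {0..T}" "S \<le> u (x0, t0) - v (x0, t0) - \<eta> * t0"
  obtains x1 x y \<tau> s where "\<tau> \<in> {0..T}" "s \<in> {0..T}" "norm (x - x1) < 1" "S - \<theta> \<le> doubled v H \<eta> x y \<tau> s"
    "\<And>x' y' \<tau>' s'. \<tau>' \<in> {0..T} \<Longrightarrow> s' \<in> {0..T} \<Longrightarrow>
      doubled v H \<eta> x' y' \<tau>' s' - \<theta> * cap (x' - x1) \<le> doubled v H \<eta> x y \<tau> s - \<theta> * cap (x - x1)"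
proof -
  define D where "D = (UNIV \<times> UNIV \<times> {0..T} \<times> {0..T} :: ('a \<times> 'a \<times> real \<times> real) set)"
  define \<Phi> where "\<Phi> = (\<lambda>(x, y, \<tau>, s). doubled v H \<eta> x y \<tau> s)"
  have le: "doubled v H \<eta> x y \<tau> s \<le> 2 * M - H * (norm (x - y))\<^sup>2" if "\<tau> \<in> {0..T}" "s \<in> {0..T}" for x y \<tau> s
  proof -
    have "0 \<le> G * (\<tau> - s)\<^sup>2" "0 \<le> \<eta> * s" using G_pos pos that by auto
    then show ?thesis
      unfolding doubled_def using u_le[OF that(1), of x] v(2)[OF that(2), of y] by linarith
  qed
  have bdd: "bdd_above (\<Phi> ` D)"
  proof (rule bdd_aboveI2)
    fix z assume "z \<in> D"
    then obtain x y \<tau> s where z: "z = (x, y, \<tau>, s)" "\<tau> \<in> {0..T}" "s \<in> {0..T}"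
      by (auto simp: D_def)
    have "0 \<le> H * (norm (x - y))\<^sup>2" using pos by simp
    then show "\<Phi> z \<le> 2 * M" using le[OF z(2,3), of x y] by (simp add: z(1) \<Phi>_def)
  qed
  have upper: "\<Phi> z \<le> Sup (\<Phi> ` D)" if "z \<in> D" for z
    using that bdd by (intro cSup_upper) auto
  have mem0: "(x0, x0, t0, t0) \<in> D" using S by (simp add: D_def)
  have "\<exists>z\<in>D. Sup (\<Phi> ` D) - \<theta> < \<Phi> z"
    using less_cSupD[of "\<Phi> ` D" "Sup (\<Phi> ` D) - \<theta>"] mem0 pos by fastforce
  then obtain z1 where z1: "z1 \<in> D" "Sup (\<Phi> ` D) - \<theta> < \<Phi> z1" by blast
  obtain x1 y1 \<tau>1 s1 where z1eq: "z1 = (x1, y1, \<tau>1, s1)" "\<tau>1 \<in> {0..T}" "s1 \<in> {0..T}"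
    using z1(1) by (auto simp: D_def)
  define \<Psi> where "\<Psi> = (\<lambda>(x, y, \<tau>, s). doubled v H \<eta> x y \<tau> s - \<theta> * cap (x - x1))"
  have \<Psi>1: "\<Psi> z1 = \<Phi> z1" by (simp add: \<Psi>_def \<Phi>_def z1eq cap_def)
  have "\<Phi> (x0, x0, 0, 0) \<ge> - 2 * M"
    using u_le[of 0 x0] v(2)[of 0 x0] T_pos by (simp add: \<Phi>_def doubled_def)
  moreover have "(x0, x0, 0, 0) \<in> D" using T_pos by (simp add: D_def)
  ultimately have low: "- 2 * M - \<theta> < \<Phi> z1" using upper z1 by force
  \<comment> \<open>At \<open>|x - y| = q\<close> the penalty reaches
    \<open>4 * M + \<theta>\<close>, which pushes the value below that of \<open>z1\<close>. In
    \<open>R\<close>, the \<open>1\<close> accounts for \<open>x\<close> in the unit ball around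
    \<open>x1\<close> and the last summand keeps \<open>z1\<close> inside \<open>E\<close>.\<close>
  define q where "q = sqrt ((4 * M + \<theta>) / H)"
  define R where "R = 1 + q + norm (y1 - x1)"
  have q: "0 \<le> q" "H * q\<^sup>2 = 4 * M + \<theta>" using pos M_nonneg by (simp_all add: q_def)
  define E where "E = cball x1 1 \<times> cball x1 R \<times> {0..T} \<times> {0..T}"
  have "usc_on E \<Psi>"
    unfolding \<Psi>_def by (rule usc_on_compose[OF doubled_usc[OF v(1)], where g = "\<lambda>z. z"]) (auto simp: E_def)
  moreover have "compact E" unfolding E_def by (intro compact_Times) auto
  moreover have z1E: "z1 \<in> E" using z1eq q by (simp add: E_def R_def dist_norm norm_minus_commute)
  ultimately obtain z where z: "z \<in> E" "\<forall>z'\<in>E. \<Psi> z' \<le> \<Psi> z"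
    using usc_on_attains_sup[of E \<Psi>] by blast
  obtain x y \<tau> s where zeq: "z = (x, y, \<tau>, s)" "\<tau> \<in> {0..T}" "s \<in> {0..T}"
    using z(1) by (auto simp: E_def)
  have \<Psi>z: "\<Phi> z1 \<le> \<Psi> z" using z z1E \<Psi>1 by auto
  \<comment> \<open>There the penalty takes the full amount \<open>\<theta>\<close>, more than
    \<open>z1\<close> lacks to the supremum.\<close>
  have far: "\<Psi> (x', y', \<tau>', s') < \<Phi> z1" if "1 \<le> norm (x' - x1)" "\<tau>' \<in> {0..T}" "s' \<in> {0..T}" for x' y' \<tau>' s'
    using upper[of "(x', y', \<tau>', s')"] z1(2) that cap_outside[OF that(1)] by (simp add: \<Psi>_def \<Phi>_def D_def)
  have max: "\<Psi> (x', y', \<tau>', s') \<le> \<Psi> z" if t': "\<tau>' \<in> {0..T}" "s' \<in> {0..T}" for x' y' \<tau>' s'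
  proof -
    consider "1 \<le> norm (x' - x1)" | "norm (x' - x1) < 1" "R < norm (y' - x1)"
      | "norm (x' - x1) < 1" "norm (y' - x1) \<le> R" by linarith
    then show ?thesis
    proof cases
      case 1
      then show ?thesis using far[OF 1 t', of y'] \<Psi>z by linarith
    next
      case 2
      have "norm (y' - x1) \<le> norm (x' - y') + norm (x' - x1)"
        using norm_triangle_ineq4[of "x' - x1" "x' - y'"] by simp
      then have "q \<le> norm (x' - y')" using 2 norm_ge_zero[of "y1 - x1"] unfolding R_def by linarith
      then have "H * q\<^sup>2 \<le> H * (norm (x' - y'))\<^sup>2"
        using q pos by (intro mult_left_mono power_mono) auto
      moreover have "0 \<le> \<theta> * cap (x' - x1)" using pos cap_bounds(1)[of "x' - x1"] by simp
      ultimately have "\<Psi> (x', y', \<tau>', s') \<le> - 2 * M - \<theta>"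
        using le[OF t', of x' y'] q by (simp add: \<Psi>_def)
      then show ?thesis using low \<Psi>z by linarith
    next
      case 3
      then have "(x', y', \<tau>', s') \<in> E" using t' by (simp add: E_def dist_norm norm_minus_commute)
      then show ?thesis using z by blast
    qed
  qed
  have near: "norm (x - x1) < 1"
    using far[OF _ zeq(2,3), of x y] \<Psi>z zeq(1) by force
  have "S - \<theta> \<le> \<Phi> z1"
    using upper[OF mem0] z1(2) S by (simp add: \<Phi>_def doubled_def)
  also have "\<dots> \<le> \<Psi> z" by (rule \<Psi>z)
  also have "\<dots> \<le> doubled v H \<eta> x y \<tau> s" using pos cap_bounds(1)[of "x - x1"] by (simp add: \<Psi>_def zeq(1))
  finally have "S - \<theta> \<le> doubled v H \<eta> x y \<tau> s" .
  then show ?thesis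
    using that[OF zeq(2,3) near] max by (simp add: \<Psi>_def zeq(1))
qed

text \<open>Both test functions contribute \<open>2 * G * (\<tau> - s)\<close>; subtracting leaves
  \<open>\<eta>\<close>. Ellipticity trades the nonlocal term at \<open>y\<close> for
  \<open>l - e\<close>, so only \<open>U\<close> has to be regular. In \<open>e\<close>, the
  curvatures \<open>H + \<theta>\<close> and \<open>- H\<close> give the \<open>M2\<close> term, the
  gradient difference gives \<open>2 * C4\<close>, and the outer increments give
  \<open>3 * tail \<delta>\<close>.\<close>

lemma doubling_inequality:
  assumes super: "visc_supersolution T \<sigma> K F v" and v_le: "\<And>x t. t \<in> {0..T} \<Longrightarrow> \<bar>v (x, t)\<bar> \<le> M"
    and pos: "0 < H" "0 < \<theta>" "0 \<le> \<eta>" "0 < \<delta>" "\<delta> < 1"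
    and S: "t0 \<in> {0..T}" "S \<le> u (x0, t0) - v (x0, t0) - \<eta> * t0" "\<theta> \<le> S / 2"
    and layer: "\<And>x y \<tau> s. \<tau> \<in> {0..T} \<Longrightarrow> s \<in> {0..T} \<Longrightarrow> s < a \<Longrightarrow> H * (norm (x - y))\<^sup>2 \<le> 2 * M \<Longrightarrow>
      G * (\<tau> - s)\<^sup>2 \<le> 2 * M \<Longrightarrow> u (x, \<tau>) - v (y, s) < S / 2"
    and C4: "\<And>p. \<bar>drift \<delta> p\<bar> \<le> C4 * norm p" "0 \<le> C4"
    and e: "e = (2 * H + \<theta>) * M2 \<delta> + \<theta> * (2 * C4 + 3 * tail \<delta>)"
  obtains x y pu pv l s where "s \<in> {a..T}" "\<eta> \<le> F y pv (l - e) - F x pu l"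
    "norm (pu - pv) \<le> 2 * \<theta>" "norm pv = 2 * H * norm (x - y)"
    "H * (norm (x - y))\<^sup>2 \<le> 2 * M" "H * (norm (x - y))\<^sup>2 \<le> U x s - U y s + \<theta>"
    "l = (H + \<theta>) * M2 \<delta> + drift \<delta> pu + nonlocal_outer \<sigma> K \<delta> (\<lambda>y. U y s) pu x"
proof -
  have v_lsc: "lsc_on (closed_parabolic_domain T) v" using super by (simp add: visc_supersolution_def)
  obtain x1 x y \<tau> s where \<tau>: "\<tau> \<in> {0..T}" and s: "s \<in> {0..T}" and near: "norm (x - x1) < 1"
    and val: "S - \<theta> \<le> doubled v H \<eta> x y \<tau> s"
    and max: "\<And>x' y' \<tau>' s'. \<tau>' \<in> {0..T} \<Longrightarrow> s' \<in> {0..T} \<Longrightarrow>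
      doubled v H \<eta> x' y' \<tau>' s' - \<theta> * cap (x' - x1) \<le> doubled v H \<eta> x y \<tau> s - \<theta> * cap (x - x1)"
    using doubled_max[OF v_lsc v_le pos(1,2,3) S(1,2)] by metis
  have nn: "0 \<le> H * (norm (x - y))\<^sup>2" "0 \<le> G * (\<tau> - s)\<^sup>2" "0 \<le> \<eta> * s" using pos G_pos s by auto
  have "S > 0" using pos S by linarith
  then have diff: "S / 2 + H * (norm (x - y))\<^sup>2 + G * (\<tau> - s)\<^sup>2 \<le> u (x, \<tau>) - v (y, s)"
    using val nn S(3) unfolding doubled_def by linarith
  have "u (x, \<tau>) - v (y, s) \<le> 2 * M" using u_le[OF \<tau>, of x] v_le[OF s, of y] by linarith
  then have Hd: "H * (norm (x - y))\<^sup>2 \<le> 2 * M" and Gd: "G * (\<tau> - s)\<^sup>2 \<le> 2 * M"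
    using diff nn \<open>S > 0\<close> by linarith+
  \<comment> \<open>In the initial layer the gap would be below \<open>S / 2\<close>, against
    \<open>diff\<close>; beyond it the estimates for \<open>U\<close> apply.\<close>
  have sa: "s \<in> {a..T}" using layer[OF \<tau> s _ Hd Gd] diff nn s by force
  have s0: "0 < s" "s \<le> T" using sa a_pos by auto
  have Ux: "U x s = u (x, \<tau>) - G * (\<tau> - s)\<^sup>2"
  proof -
    obtain \<tau>' where \<tau>': "\<tau>' \<in> {0..T}" "U x s = u (x, \<tau>') - G * (\<tau>' - s)\<^sup>2" using U_attained by blast
    then show ?thesis
      using max[OF \<tau>'(1) s, of x y] U_ge[OF \<tau>, of x s] by (simp add: doubled_def)
  qed
  have UU: "U x' s - v (y', s) - H * (norm (x' - y'))\<^sup>2 - \<theta> * cap (x' - x1)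
      \<le> U x s - v (y, s) - H * (norm (x - y))\<^sup>2 - \<theta> * cap (x - x1)" for x' y'
  proof -
    obtain \<tau>' where \<tau>': "\<tau>' \<in> {0..T}" "U x' s = u (x', \<tau>') - G * (\<tau>' - s)\<^sup>2" using U_attained by blast
    then show ?thesis using max[OF \<tau>'(1) s, of x' y'] Ux by (simp add: doubled_def)
  qed
  define pu where "pu = (2 * (H + \<theta>)) *\<^sub>R x + (- (2 * H) *\<^sub>R y - (2 * \<theta>) *\<^sub>R x1)"
  define pv where "pv = (2 * (- H)) *\<^sub>R y + (2 * H) *\<^sub>R x"
  define l1 where "l1 = (H + \<theta>) * M2 \<delta> + drift \<delta> pu + nonlocal_outer \<sigma> K \<delta> (\<lambda>y. U y s) pu x"
  define l2 where "l2 = - H * M2 \<delta> + drift \<delta> pv + nonlocal_outer \<sigma> K \<delta> (\<lambda>y. v (y, s)) pv y"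
  have pdiff: "pu - pv = (2 * \<theta>) *\<^sub>R (x - x1)"
    by (simp add: pu_def pv_def algebra_simps)
  have pd: "norm (pu - pv) \<le> 2 * \<theta>"
    unfolding pdiff using pos near by (simp add: mult_left_le)
  have "pv = (2 * H) *\<^sub>R (x - y)" by (simp add: pv_def algebra_simps)
  then have pvn: "norm pv = 2 * H * norm (x - y)" using pos by simp
  have sub1: "2 * G * (\<tau> - s) + F x pu l1 \<le> 0"
    unfolding l1_def
  proof (rule U_subsolution[OF sa \<tau> Ux pos(4,5) _ pu_def])
    fix y'
    have sq: "(H + \<theta>) * (w \<bullet> w) + (- (2 * H) *\<^sub>R y - (2 * \<theta>) *\<^sub>R x1) \<bullet> w
        = H * (norm (w - y))\<^sup>2 + \<theta> * (norm (w - x1))\<^sup>2 - (H * (y \<bullet> y) + \<theta> * (x1 \<bullet> x1))" for w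
      by (simp add: power2_norm_eq_inner inner_diff_left inner_diff_right inner_commute algebra_simps)
    have "\<theta> * cap (y' - x1) \<le> \<theta> * (norm (y' - x1))\<^sup>2"
      using pos cap_bounds by (intro mult_left_mono) auto
    then show "U y' s - ((H + \<theta>) * (y' \<bullet> y') + (- (2 * H) *\<^sub>R y - (2 * \<theta>) *\<^sub>R x1) \<bullet> y')
        \<le> U x s - ((H + \<theta>) * (x \<bullet> x) + (- (2 * H) *\<^sub>R y - (2 * \<theta>) *\<^sub>R x1) \<bullet> x)"
      unfolding sq using UU[of y' y] cap_inside[OF near] by simp
  qed
  have super1: "0 \<le> 2 * G * (\<tau> - s) - \<eta> + F y pv l2"
  proof -
    \<comment> \<open>Its time derivative at \<open>s\<close> is
      \<open>2 * G * (\<tau> - s) - \<eta>\<close>.\<close>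
    let ?\<phi> = "quad (- H) ((2 * H) *\<^sub>R x) (- G) (2 * G * \<tau> - \<eta>)"
    have eq: "v (y', s') - ?\<phi> (y', s') = u (x, \<tau>) - doubled v H \<eta> x y' \<tau> s' - H * (x \<bullet> x) - G * \<tau>\<^sup>2" for y' s'
    proof -
      have n2: "(norm (x - y'))\<^sup>2 = x \<bullet> x - 2 * (x \<bullet> y') + y' \<bullet> y'"
        by (simp add: power2_norm_eq_inner inner_diff_left inner_diff_right inner_commute)
      show ?thesis
        unfolding quad_def doubled_def n2 by (simp add: power2_diff algebra_simps)
    qed
    have "v (y, s) - ?\<phi> (y, s) \<le> v (y', s') - ?\<phi> (y', s')" if "s' \<in> {0..T}" for y' s'
      unfolding eq using max[OF \<tau> that, of x y'] by simp
    then have "\<forall>(y', s')\<in>(ball y \<delta> \<times> {s - \<delta><..<s + \<delta>}) \<inter> parabolic_domain T.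
        v (y, s) - ?\<phi> (y, s) \<le> v (y', s') - ?\<phi> (y', s')"
      by (auto simp: parabolic_domain_def)
    moreover have "(y, s) \<in> parabolic_domain T" using s0 by (simp add: parabolic_domain_def)
    ultimately have "0 \<le> visc_lhs T \<sigma> K F \<delta> v ?\<phi> y s"
      using super C2_on_quad pos(4,5) unfolding visc_supersolution_def by blast
    then show ?thesis
      unfolding visc_lhs_quad[OF pos(4,5) s0] pv_def[symmetric] l2_def by (simp add: algebra_simps)
  qed
  \<comment> \<open>Moving both points by the same \<open>z\<close> leaves \<open>x - y\<close>
    unchanged. One \<open>\<theta>\<close> pays for \<open>cap\<close>, two for the compensators
    with gradients \<open>pu\<close> and \<open>pv\<close>.\<close>
  have "nonlocal_outer \<sigma> K \<delta> (\<lambda>y. U y s) pu x \<le> nonlocal_outer \<sigma> K \<delta> (\<lambda>y. v (y, s)) pv y + 3 * \<theta> * tail \<delta>"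
  proof (rule nonlocal_outer_mono[where ?B1.0 = M and ?B2.0 = M])
    have "(\<lambda>y. - v (y, s)) \<in> borel_measurable borel"
      using usc_on_closed_domain_slice[OF usc_on_uminus[OF v_lsc] s]
      by (rule usc_on_UNIV_borel_measurable)
    then show "(\<lambda>y. v (y, s)) \<in> borel_measurable borel"
      using borel_measurable_uminus by fastforce
    show "\<bar>U y s\<bar> \<le> M" for y using U_bound s by simp
    show "\<bar>v (y, s)\<bar> \<le> M" for y using v_le s by simp
    fix z :: 'a
    have "\<theta> * cap (x + z - x1) \<le> \<theta> * 1" "0 \<le> \<theta> * cap (x - x1)"
      using pos cap_bounds(1)[of "x - x1"] cap_bounds(2)[of "x + z - x1"] by (auto simp: mult_left_le)
    then have 1: "U (x + z) s - U x s \<le> v (y + z, s) - v (y, s) + \<theta>"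
      using UU[of "x + z" "y + z"] by simp
    have "norm (pu - pv) * (norm z * indicator (ball 0 1) z) \<le> 2 * \<theta> * 1"
      using pd pos by (intro mult_mono) (auto simp: indicator_def)
    then have "\<bar>I_ind \<sigma> * indicator (ball 0 1) z * ((pu - pv) \<bullet> z)\<bar> \<le> 2 * \<theta>"
      using compensator_le[of z "pu - pv"] by linarith
    then show "U (x + z) s - U x s - I_ind \<sigma> * indicator (ball 0 1) z * (pu \<bullet> z)
        \<le> v (y + z, s) - v (y, s) - I_ind \<sigma> * indicator (ball 0 1) z * (pv \<bullet> z) + 3 * \<theta>"
      using 1 unfolding inner_diff_left right_diff_distrib by linarith
  qed (use U_measurable pos in auto)
  moreover have "drift \<delta> pu - drift \<delta> pv \<le> C4 * (2 * \<theta>)"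
    using C4(1)[of "pu - pv"] mult_left_mono[OF pd C4(2)] drift_diff[OF pos(4), of pu pv] by linarith
  ultimately have "l1 - e \<le> l2"
    unfolding l1_def l2_def e by (simp add: algebra_simps)
  then have "F y pv l2 \<le> F y pv (l1 - e)" by (rule F_mono)
  then have "\<eta> \<le> F y pv (l1 - e) - F x pu l1" using sub1 super1 by linarith
  \<comment> \<open>Moving only the first point, to \<open>y\<close>, eliminates \<open>v\<close>
    and links the penalty to the oscillation of \<open>U\<close>.\<close>
  moreover have "H * (norm (x - y))\<^sup>2 \<le> U x s - U y s + \<theta>"
  proof -
    have "\<theta> * cap (y - x1) \<le> \<theta> * 1" "0 \<le> \<theta> * cap (x - x1)"
      using pos cap_bounds(1)[of "x - x1"] cap_bounds(2)[of "y - x1"] by (auto simp: mult_left_le)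
    then show ?thesis using UU[of y y] by simp
  qed
  ultimately show ?thesis using that[OF sa _ pd pvn Hd _ l1_def] by blast
qed

lemma doubling_contradiction:
  assumes super: "visc_supersolution T \<sigma> K F v" and v_le: "\<And>x t. t \<in> {0..T} \<Longrightarrow> \<bar>v (x, t)\<bar> \<le> M"
    and nm: "0 < n" "0 \<le> m" and mod: "modulus_of_continuity \<omega>"
    and F_cont: "\<And>x1 x2 p1 p2 l1 l2.
      \<bar>F x1 p1 l1 - F x2 p2 l2\<bar> \<le>
        \<omega> (\<bar>l1 - l2\<bar>
          + norm (x1 - x2) *
              (1 + max \<bar>l1\<bar> \<bar>l2\<bar> + (max (norm p1) (norm p2)) powr m) powr n
          + norm (p1 - p2) *
              (1 + max \<bar>l1\<bar> \<bar>l2\<bar> + (max (norm p1) (norm p2)) powr m) powr n)"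
    and S: "0 < S" "0 < \<eta>" "t0 \<in> {0..T}" "S \<le> u (x0, t0) - v (x0, t0) - \<eta> * t0"
    and layer: "0 < \<rho>" "\<And>x y \<tau> s. \<tau> \<in> {0..T} \<Longrightarrow> s \<in> {0..T} \<Longrightarrow> s < a \<Longrightarrow> norm (x - y) < \<rho> \<Longrightarrow>
      G * (\<tau> - s)\<^sup>2 \<le> 2 * M \<Longrightarrow> u (x, \<tau>) - v (y, s) < S / 2"
  shows False
proof -
  \<comment> \<open>Largest exponents needed, in units of \<open>\<beta>\<close>:
    \<open>5 = 2 + 3\<close> from the gradient times the shell integral at radius
    \<open>\<epsilon>^3\<close>, and \<open>2 * m\<close> from \<open>|p|^m\<close>. The bound
    \<open>1 / (2 * n * B)\<close> on \<open>\<beta>\<close> makes the \<open>n\<close>-th power of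
    the weight cost at most \<open>\<epsilon>^(-1/2)\<close>.\<close>
  define B where "B = 5 + 2 * m"
  have B: "5 \<le> B" "2 * m \<le> B" using nm by (simp_all add: B_def)
  have "0 < 1 / (2 * n * B)" using nm B by simp
  then obtain \<beta> where \<beta>: "0 < \<beta>" "\<beta> \<le> 1 / (2 * n * B)" "\<beta> \<le> 1" "holder \<beta>"
    using holder_small by blast
  obtain A where A: "A \<ge> 0" "\<forall>t\<in>{a..T}. \<forall>x y. U y t - U x t \<le> A * norm (y - x) powr (1 - \<beta>)"
    using \<beta>(4) unfolding holder_def by blast
  obtain C2 where C2: "C2 \<ge> 0" "\<And>\<delta>. 0 < \<delta> \<Longrightarrow> \<delta> \<le> 1 \<Longrightarrow> M2 \<delta> \<le> C2 * \<delta>" using M2_bound by blast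
  obtain C4 where C4: "C4 \<ge> 0" "\<And>\<delta> p. 0 < \<delta> \<Longrightarrow> \<delta> \<le> 1 \<Longrightarrow> \<bar>drift \<delta> p\<bar> \<le> C4 * norm p"
    using drift_bound by blast
  obtain S1 where S1: "S1 \<ge> 0" "\<And>\<delta>. 0 < \<delta> \<Longrightarrow> shell \<beta> \<delta> \<le> S1 * \<delta> powr - \<beta>"
    using shell_bound[OF \<beta>(1)] by blast
  \<comment> \<open>Constants free of \<open>\<epsilon>\<close>: the gradients are at most
    \<open>P * \<epsilon>^(-2 * \<beta>)\<close>, \<open>|l|\<close> at most \<open>D * X\<close>,
    the base of the weight at most \<open>W * X\<close>, and the argument of \<open>\<omega>\<close>
    at most \<open>Z * sqrt \<epsilon>\<close>.\<close>
  define P where "P = 2 * A + 4"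
  define D where "D = 2 * C2 + C4 * P + A * S1 + 2 * M * tail 1 + P * S1"
  define W where "W = 1 + D + (3 * C2 + 1) + P powr m"
  define Z where "Z = (3 * C2 + 1) + (sqrt (2 * M) + 2) * W powr n"
  have P: "4 \<le> P" using A by (simp add: P_def)
  have D: "0 \<le> D" unfolding D_def
    using C2 C4 S1 A P M_nonneg tail_nonneg by (intro add_nonneg_nonneg mult_nonneg_nonneg) auto
  have W: "1 \<le> W" unfolding W_def using D C2 by simp
  have "0 < 3 * C2 + 1" "0 \<le> (sqrt (2 * M) + 2) * W powr n" using C2 M_nonneg by simp_all
  then have Z: "0 < Z" unfolding Z_def by (rule add_pos_nonneg)
  obtain r0 where r0: "0 < r0" "\<And>t. 0 \<le> t \<Longrightarrow> t < r0 \<Longrightarrow> \<omega> t < \<eta>"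
    using modulus_of_continuity_small[OF mod S(2)] by blast
  have ev: "\<forall>\<^sub>F \<epsilon> in at_right (0::real). Z * sqrt \<epsilon> < r0 \<and> sqrt (2 * M) * \<epsilon> < \<rho> \<and> \<epsilon> < 1 \<and> 0 < \<epsilon>"
  proof (intro eventually_conj)
    have "((\<lambda>\<epsilon>. Z * sqrt \<epsilon>) \<longlongrightarrow> Z * sqrt 0) (at_right 0)" by (intro tendsto_intros)
    then show "\<forall>\<^sub>F \<epsilon> in at_right 0. Z * sqrt \<epsilon> < r0" using r0(1) by (intro order_tendstoD) auto
    have "((\<lambda>\<epsilon>. sqrt (2 * M) * \<epsilon>) \<longlongrightarrow> sqrt (2 * M) * 0) (at_right 0)" by (intro tendsto_intros)
    then show "\<forall>\<^sub>F \<epsilon> in at_right 0. sqrt (2 * M) * \<epsilon> < \<rho>" using layer(1) by (intro order_tendstoD) auto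
    have "((\<lambda>\<epsilon>. \<epsilon>) \<longlongrightarrow> (0::real)) (at_right 0)" by (intro tendsto_intros)
    then show "\<forall>\<^sub>F \<epsilon> in at_right (0::real). \<epsilon> < 1" by (intro order_tendstoD) auto
    show "\<forall>\<^sub>F \<epsilon> in at_right (0::real). 0 < \<epsilon>" by (rule eventually_at_right_less)
  qed
  obtain \<epsilon> where \<epsilon>: "Z * sqrt \<epsilon> < r0" "sqrt (2 * M) * \<epsilon> < \<rho>" "\<epsilon> < 1" "0 < \<epsilon>"
    using eventually_happens[OF ev] by auto
  define H where "H = 1 / \<epsilon>\<^sup>2"
  \<comment> \<open>Since \<open>M2 \<delta> = O(\<delta>)\<close>, this radius gives
    \<open>H * M2 \<delta> = O(\<epsilon>)\<close>.\<close>
  define \<delta> where "\<delta> = \<epsilon> ^ 3"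
  have H: "0 < H" using \<epsilon> by (simp add: H_def)
  have \<delta>: "0 < \<delta>" "\<delta> < 1" "\<delta> \<le> \<epsilon>" and \<epsilon>2: "\<epsilon>\<^sup>2 \<le> \<epsilon>" "\<epsilon>\<^sup>2 \<le> 1" "0 < \<epsilon>\<^sup>2"
    using \<epsilon> power_strict_decreasing[of 0 3 \<epsilon>] power_decreasing[of 1 3 \<epsilon>]
      power_decreasing[of 1 2 \<epsilon>] power_decreasing[of 0 2 \<epsilon>] by (auto simp: \<delta>_def)
  define k where "k = 1 + 2 * C4 + 3 * tail \<delta>"
  have k: "1 \<le> k" using C4 tail_nonneg[of \<delta>] by (simp add: k_def)
  \<comment> \<open>Chosen after \<open>\<delta>\<close>, because \<open>tail \<delta>\<close> may
    be large: \<open>\<theta> * k \<le> \<epsilon>\<close> absorbs it. The bound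
    \<open>\<epsilon>^2\<close> controls the gradient difference and the remainder in the gradient
    estimate; \<open>S / 2\<close> keeps half of the gap.\<close>
  define \<theta> where "\<theta> = min (min (\<epsilon>\<^sup>2) (\<epsilon> / k)) (S / 2)"
  have \<theta>: "0 < \<theta>" "\<theta> \<le> \<epsilon>\<^sup>2" "\<theta> \<le> S / 2" "\<theta> \<le> \<epsilon> / k"
  proof -
    show "0 < \<theta>" using \<epsilon> S k by (simp add: \<theta>_def)
    show "\<theta> \<le> \<epsilon>\<^sup>2" "\<theta> \<le> S / 2" "\<theta> \<le> \<epsilon> / k" unfolding \<theta>_def by linarith+
  qed
  have \<theta>k: "\<theta> * k \<le> \<epsilon>" using \<theta>(4) k by (simp add: field_simps)
  have d_le: "norm w \<le> sqrt (2 * M) * \<epsilon>" if "H * (norm w)\<^sup>2 \<le> 2 * M" for w :: 'a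
  proof -
    have "(norm w)\<^sup>2 \<le> 2 * M * \<epsilon>\<^sup>2" using that \<epsilon> by (simp add: H_def field_simps)
    then have "norm w \<le> sqrt (2 * M * \<epsilon>\<^sup>2)" by (rule real_le_rsqrt)
    then show ?thesis using \<epsilon> by (simp add: real_sqrt_mult)
  qed
  define e where "e = (2 * H + \<theta>) * M2 \<delta> + \<theta> * (2 * C4 + 3 * tail \<delta>)"
  obtain x y pu pv l s where s: "s \<in> {a..T}" and \<eta>: "\<eta> \<le> F y pv (l - e) - F x pu l"
    and pd: "norm (pu - pv) \<le> 2 * \<theta>" and pv: "norm pv = 2 * H * norm (x - y)"
    and Hd: "H * (norm (x - y))\<^sup>2 \<le> 2 * M" and HU: "H * (norm (x - y))\<^sup>2 \<le> U x s - U y s + \<theta>"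
    and l: "l = (H + \<theta>) * M2 \<delta> + drift \<delta> pu + nonlocal_outer \<sigma> K \<delta> (\<lambda>y. U y s) pu x"
  proof (rule doubling_inequality[OF super v_le H \<theta>(1) _ \<delta>(1,2) S(3,4) \<theta>(3) _ _ C4(1) e_def])
    show "0 \<le> \<eta>" using S by simp
    show "\<bar>drift \<delta> p\<bar> \<le> C4 * norm p" for p using C4(2) \<delta> by simp
    show "u (x, \<tau>) - v (y, s) < S / 2" if "\<tau> \<in> {0..T}" "s \<in> {0..T}" "s < a" "H * (norm (x - y))\<^sup>2 \<le> 2 * M"
      "G * (\<tau> - s)\<^sup>2 \<le> 2 * M" for x y \<tau> s
      using layer(2)[OF that(1,2,3) _ that(5)] d_le[OF that(4)] \<epsilon>(2) by simp
  qed blast+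
  define d where "d = norm (x - y)"
  have d: "0 \<le> d" "d \<le> sqrt (2 * M) * \<epsilon>" using d_le[OF Hd] by (simp_all add: d_def)
  have HM2: "H * M2 \<delta> \<le> C2 * \<epsilon>"
  proof -
    have "H * M2 \<delta> \<le> H * (C2 * \<delta>)" using C2(2)[of \<delta>] \<delta> H by (intro mult_left_mono) auto
    also have "\<dots> = C2 * \<epsilon>" using \<epsilon> by (simp add: H_def \<delta>_def power2_eq_square power3_eq_cube)
    finally show ?thesis .
  qed
  have \<theta>M2: "\<theta> * M2 \<delta> \<le> C2 * \<epsilon>"
  proof -
    have "\<theta> * M2 \<delta> \<le> 1 * (C2 * \<delta>)"
      using C2 \<theta> \<epsilon>2 \<delta> M2_nonneg by (intro mult_mono) auto
    also have "\<dots> \<le> C2 * \<epsilon>" using C2 \<delta> by (simp add: mult_left_mono)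
    finally show ?thesis .
  qed
  have e: "0 \<le> e" "e \<le> (3 * C2 + 1) * \<epsilon>"
  proof -
    show "0 \<le> e" unfolding e_def using H \<theta> M2_nonneg C4 tail_nonneg[of \<delta>] by simp
    have "\<theta> * (2 * C4 + 3 * tail \<delta>) \<le> \<theta> * k" using \<theta> by (intro mult_left_mono) (auto simp: k_def)
    then show "e \<le> (3 * C2 + 1) * \<epsilon>"
      unfolding e_def using HM2 \<theta>M2 \<theta>k by (simp add: algebra_simps)
  qed
  define X where "X = \<epsilon> powr - (B * \<beta>)"
  have mono: "\<epsilon> powr - (q * \<beta>) \<le> X" if "q \<le> B" for q
    unfolding X_def using that \<epsilon> \<beta> by (intro powr_mono') auto
  have X1: "1 \<le> X" using mono[of 0] B \<epsilon> by simp
  \<comment> \<open>For \<open>d \<le> \<epsilon>^2\<close> the gradient is at most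
    \<open>2\<close>. Otherwise \<open>\<theta> \<le> d^(1 - \<beta>)\<close>, and Hoelder
    continuity in \<open>HU\<close> gives
    \<open>d / \<epsilon>^2 \<le> (A + 1) * d^(-\<beta>)\<close>, where
    \<open>d > \<epsilon>^2\<close> is used once more.\<close>
  have pv_le: "norm pv \<le> 2 * (A + 1) * \<epsilon> powr - (2 * \<beta>)"
  proof -
    have one: "1 \<le> \<epsilon> powr - (2 * \<beta>)" using powr_mono'[of "- (2 * \<beta>)" 0 \<epsilon>] \<epsilon> \<beta> by simp
    have "d / \<epsilon>\<^sup>2 \<le> (A + 1) * \<epsilon> powr - (2 * \<beta>)"
    proof (cases "d \<le> \<epsilon>\<^sup>2")
      case True
      then have "d / \<epsilon>\<^sup>2 \<le> 1 * 1" using \<epsilon> by simp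
      also have "\<dots> \<le> (A + 1) * \<epsilon> powr - (2 * \<beta>)" using A one by (intro mult_mono) auto
      finally show ?thesis .
    next
      case False
      then have d0: "0 < d" "\<epsilon>\<^sup>2 \<le> d" using \<epsilon>2 by linarith+
      have "\<theta> \<le> (\<epsilon>\<^sup>2) powr 1" using \<theta> by simp
      also have "\<dots> \<le> (\<epsilon>\<^sup>2) powr (1 - \<beta>)" using \<epsilon>2 \<beta> \<epsilon> by (intro powr_mono') auto
      also have "\<dots> \<le> d powr (1 - \<beta>)" using d0 \<beta> \<epsilon>2 by (intro powr_mono2) auto
      finally have "H * d\<^sup>2 \<le> A * d powr (1 - \<beta>) + d powr (1 - \<beta>)"
        using HU A(2)[rule_format, OF s, of x y] by (simp add: d_def)
      then have "(d / \<epsilon>\<^sup>2) * d \<le> (A + 1) * d powr (1 - \<beta>)"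
        by (simp add: H_def power2_eq_square algebra_simps)
      also have "d powr (1 - \<beta>) = d powr - \<beta> * d"
        using d0 by (simp add: powr_diff powr_minus field_simps)
      finally have "(d / \<epsilon>\<^sup>2) * d \<le> ((A + 1) * d powr - \<beta>) * d" by (simp add: mult_ac)
      then have "d / \<epsilon>\<^sup>2 \<le> (A + 1) * d powr - \<beta>"
        using d0 by (simp only: mult_le_cancel_right_pos)
      also have "\<dots> \<le> (A + 1) * (\<epsilon>\<^sup>2) powr - \<beta>"
        using d0 \<beta> A \<epsilon>2 by (intro mult_left_mono powr_mono2') auto
      also have "(\<epsilon>\<^sup>2) powr - \<beta> = \<epsilon> powr - (2 * \<beta>)"
        using \<epsilon> powr_powr[of \<epsilon> 2 "- \<beta>"] by (simp add: powr_numeral)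
      finally show ?thesis .
    qed
    then have "2 * (d / \<epsilon>\<^sup>2) \<le> 2 * ((A + 1) * \<epsilon> powr - (2 * \<beta>))" by simp
    moreover have "norm pv = 2 * (d / \<epsilon>\<^sup>2)" unfolding pv by (simp add: H_def d_def)
    ultimately show ?thesis by (simp only: mult.assoc)
  qed
  define Y where "Y = P * \<epsilon> powr - (2 * \<beta>)"
  have pu_le: "norm pu \<le> Y" and pv_le': "norm pv \<le> Y"
  proof -
    have one: "1 \<le> \<epsilon> powr - (2 * \<beta>)" using powr_mono'[of "- (2 * \<beta>)" 0 \<epsilon>] \<epsilon> \<beta> by simp
    have "norm pu \<le> norm pv + norm (pu - pv)" using norm_triangle_ineq[of pv "pu - pv"] by simp
    moreover have "norm (pu - pv) \<le> 2 * \<epsilon> powr - (2 * \<beta>)" using pd \<theta> \<epsilon>2 one by linarith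
    ultimately show "norm pu \<le> Y" using pv_le by (simp add: Y_def P_def algebra_simps)
    show "norm pv \<le> Y" using pv_le one by (simp add: Y_def P_def algebra_simps)
  qed
  have l_le: "\<bar>l\<bar> \<le> D * X"
  proof -
    have sh: "shell \<beta> \<delta> \<le> S1 * \<epsilon> powr - (3 * \<beta>)"
    proof -
      have "\<delta> powr - \<beta> = \<epsilon> powr - (3 * \<beta>)"
        using \<epsilon> powr_powr[of \<epsilon> 3 "- \<beta>"] by (simp add: \<delta>_def powr_numeral)
      then show ?thesis using S1(2)[OF \<delta>(1)] by simp
    qed
    have m2: "\<epsilon> powr - (2 * \<beta>) \<le> X" and m3: "\<epsilon> powr - (3 * \<beta>) \<le> X" and m5: "\<epsilon> powr - (5 * \<beta>) \<le> X"
      using mono[of 2] mono[of 3] mono[of 5] B by auto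
    have b1: "\<bar>(H + \<theta>) * M2 \<delta>\<bar> \<le> 2 * C2 * X"
    proof -
      have "\<bar>(H + \<theta>) * M2 \<delta>\<bar> = H * M2 \<delta> + \<theta> * M2 \<delta>"
        using H \<theta> M2_nonneg by (simp add: distrib_right)
      also have "\<dots> \<le> 2 * C2 * \<epsilon>" using HM2 \<theta>M2 by simp
      also have "\<dots> \<le> 2 * C2 * X" using C2 \<epsilon> X1 by (intro mult_left_mono) auto
      finally show ?thesis .
    qed
    have b2: "\<bar>drift \<delta> pu\<bar> \<le> C4 * P * X"
    proof -
      have "\<bar>drift \<delta> pu\<bar> \<le> C4 * norm pu" using C4(2) \<delta> by simp
      also have "\<dots> \<le> C4 * (P * X)"
        using pu_le m2 P C4 unfolding Y_def by (intro mult_left_mono order_trans[OF pu_le[unfolded Y_def]]) auto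
      finally show ?thesis by (simp add: mult_ac)
    qed
    \<comment> \<open>Here the compensator exponent is \<open>\<beta>\<close> itself, so one shell
      constant \<open>S1\<close> serves twice.\<close>
    have b3: "\<bar>nonlocal_outer \<sigma> K \<delta> (\<lambda>y. U y s) pu x\<bar> \<le> A * S1 * X + 2 * M * tail 1 * X + P * S1 * X"
    proof -
      have "\<bar>nonlocal_outer \<sigma> K \<delta> (\<lambda>y. U y s) pu x\<bar> \<le> A * shell \<beta> \<delta> + 2 * M * tail 1 + norm pu * shell \<beta> \<delta>"
        using s a_pos by (intro nonlocal_outer_bound U_measurable U_bound holder_abs[OF A(2)] A \<beta> \<delta>) auto
      moreover have "A * shell \<beta> \<delta> \<le> A * (S1 * X)"
        using A S1 m3 by (intro mult_left_mono order_trans[OF sh]) auto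
      moreover have "2 * M * tail 1 * 1 \<le> 2 * M * tail 1 * X"
        using X1 M_nonneg tail_nonneg by (intro mult_left_mono) auto
      moreover have "norm pu * shell \<beta> \<delta> \<le> P * S1 * X"
      proof -
        have "norm pu * shell \<beta> \<delta> \<le> (P * \<epsilon> powr - (2 * \<beta>)) * (S1 * \<epsilon> powr - (3 * \<beta>))"
          using pu_le[unfolded Y_def] sh P shell_nonneg by (intro mult_mono) auto
        also have "\<dots> = P * S1 * (\<epsilon> powr - (2 * \<beta>) * \<epsilon> powr - (3 * \<beta>))" by simp
        also have "\<epsilon> powr - (2 * \<beta>) * \<epsilon> powr - (3 * \<beta>) = \<epsilon> powr - (5 * \<beta>)"
          by (simp add: powr_add[symmetric])
        also have "P * S1 * \<dots> \<le> P * S1 * X" using P S1 m5 by (intro mult_left_mono) auto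
        finally show ?thesis .
      qed
      ultimately show ?thesis by (simp add: mult_ac)
    qed
    show ?thesis
      using b1 b2 b3 unfolding l D_def by (simp add: distrib_right)
  qed
  define Q where "Q = (1 + max \<bar>l - e\<bar> \<bar>l\<bar> + (max (norm pv) (norm pu)) powr m) powr n"
  have Q: "0 \<le> Q" "Q \<le> W powr n * \<epsilon> powr - (1 / 2)"
  proof -
    show "0 \<le> Q" by (simp add: Q_def)
    have "max (norm pv) (norm pu) powr m \<le> Y powr m"
      using pu_le pv_le' nm by (intro powr_mono2) (auto simp: le_max_iff_disj)
    also have "\<dots> = P powr m * \<epsilon> powr - (2 * m * \<beta>)"
      using P \<epsilon> by (simp add: Y_def powr_mult powr_powr mult_ac)
    also have "\<dots> \<le> P powr m * X" using mono[of "2 * m"] B by (intro mult_left_mono) auto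
    finally have pm: "max (norm pv) (norm pu) powr m \<le> P powr m * X" .
    have "e \<le> (3 * C2 + 1) * 1" using e(2) C2 \<epsilon> mult_left_mono[of \<epsilon> 1 "3 * C2 + 1"] by linarith
    also have "\<dots> \<le> (3 * C2 + 1) * X" using X1 C2 by (intro mult_left_mono) auto
    finally have "max \<bar>l - e\<bar> \<bar>l\<bar> \<le> D * X + (3 * C2 + 1) * X" using l_le e(1) by linarith
    moreover have "W * X = X + D * X + (3 * C2 + 1) * X + P powr m * X"
      by (simp add: W_def algebra_simps)
    ultimately have "1 + max \<bar>l - e\<bar> \<bar>l\<bar> + (max (norm pv) (norm pu)) powr m \<le> W * X"
      using pm X1 by linarith
    then have "Q \<le> (W * X) powr n"
      unfolding Q_def using nm by (intro powr_mono2) (auto simp: le_max_iff_disj intro!: add_nonneg_nonneg)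
    also have "\<dots> = W powr n * X powr n" using W X1 by (simp add: powr_mult)
    also have "X powr n = \<epsilon> powr - (B * \<beta> * n)" by (simp add: X_def powr_powr)
    also have "\<dots> \<le> \<epsilon> powr - (1 / 2)"
    proof -
      have "B * \<beta> * n \<le> 1 / 2" using \<beta>(2) B nm by (simp add: field_simps)
      then show ?thesis using \<epsilon> by (intro powr_mono') auto
    qed
    finally show "Q \<le> W powr n * \<epsilon> powr - (1 / 2)" using W by (simp add: mult_left_mono)
  qed
  have sq: "\<epsilon> * \<epsilon> powr - (1 / 2) = sqrt \<epsilon>"
  proof -
    have "\<epsilon> powr 1 * \<epsilon> powr - (1 / 2) = \<epsilon> powr (1 / 2)" unfolding powr_add[symmetric] by simp
    then show ?thesis using \<epsilon> by (simp add: powr_half_sqrt)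
  qed
  define arg where "arg = \<bar>(l - e) - l\<bar> + norm (y - x) * Q + norm (pv - pu) * Q"
  have "\<eta> \<le> \<omega> arg"
    using \<eta> F_cont[of y pv "l - e" x pu l] unfolding arg_def Q_def by linarith
  have arg0: "0 \<le> arg" unfolding arg_def using Q by simp
  have "norm (y - x) * Q + norm (pv - pu) * Q = (d + norm (pu - pv)) * Q"
    by (simp add: d_def norm_minus_commute distrib_right)
  also have "\<dots> \<le> (sqrt (2 * M) * \<epsilon> + 2 * \<epsilon>) * (W powr n * \<epsilon> powr - (1 / 2))"
    using d pd \<theta> \<epsilon>2 Q M_nonneg \<epsilon> by (intro mult_mono add_mono) auto
  also have "\<dots> = (sqrt (2 * M) + 2) * W powr n * (\<epsilon> * \<epsilon> powr - (1 / 2))"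
    by (simp add: algebra_simps)
  also have "\<dots> = (sqrt (2 * M) + 2) * W powr n * sqrt \<epsilon>" unfolding sq ..
  finally have 1: "norm (y - x) * Q + norm (pv - pu) * Q \<le> (sqrt (2 * M) + 2) * W powr n * sqrt \<epsilon>" .
  have "\<epsilon> \<le> sqrt \<epsilon>" using \<epsilon> \<epsilon>2 by (intro real_le_rsqrt) auto
  then have "(3 * C2 + 1) * \<epsilon> \<le> (3 * C2 + 1) * sqrt \<epsilon>" using C2 by (intro mult_left_mono) auto
  then have "arg \<le> Z * sqrt \<epsilon>" using 1 e unfolding arg_def Z_def by (simp add: distrib_right)
  then have "arg < r0" using \<epsilon>(1) by simp
  then have "\<omega> arg < \<eta>" using r0(2) arg0 by simp
  then show False using \<open>\<eta> \<le> \<omega> arg\<close> by simp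
qed

end

section \<open>Comparison and uniqueness for the Cauchy problem\<close>

theorem theorem3p2:
  fixes T \<sigma> n m m' C c :: real
    and K kbar :: "'a::euclidean_space \<Rightarrow> real"
    and F :: "'a \<Rightarrow> 'a \<Rightarrow> real \<Rightarrow> real"
    and \<omega> :: "real \<Rightarrow> real"
    and u0 :: "'a \<Rightarrow> real"
  assumes "0 < T"
    and "0 < \<sigma>" and "\<sigma> \<le> 1"
    and "\<And>z. 0 \<le> K z"
    and "K \<in> borel_measurable lebesgue"
    and "\<And>z. z \<noteq> 0 \<Longrightarrow> kbar z = K z * norm z powr (real DIM('a) + \<sigma>)"
    and "bounded (range kbar)"
    and "isCont kbar 0"
    and "0 < kbar 0"
    and "continuous_on UNIV (\<lambda>(x, p, l). F x p l)"
    and "0 < n" and "1 < m"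
    and "modulus_of_continuity \<omega>"
    and "\<And>x1 x2 p1 p2 l1 l2.
      \<bar>F x1 p1 l1 - F x2 p2 l2\<bar> \<le>
        \<omega> (\<bar>l1 - l2\<bar>
          + norm (x1 - x2) *
              (1 + max \<bar>l1\<bar> \<bar>l2\<bar> + (max (norm p1) (norm p2)) powr m) powr n
          + norm (p1 - p2) *
              (1 + max \<bar>l1\<bar> \<bar>l2\<bar> + (max (norm p1) (norm p2)) powr m) powr n)"
    and "\<And>x p l1 l2. l2 \<le> l1 \<Longrightarrow> F x p l1 \<le> F x p l2"
    and "1 < m'" and "0 < C" and "0 < c"
    and "\<And>x p l. c * norm p powr m' - C * (\<bar>l\<bar> + 1) \<le> F x p l"
    and "bounded (range u0)"
    and "uniformly_continuous_on UNIV u0"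
  shows
    "(\<forall>u_lower u_upper \<omega>0.
        visc_supersolution T \<sigma> K F u_lower \<and> visc_subsolution T \<sigma> K F u_upper \<and>
        modulus_of_continuity \<omega>0 \<and>
        attains_initial_with T u0 \<omega>0 u_lower \<and> attains_initial_with T u0 \<omega>0 u_upper \<longrightarrow>
        (\<forall>z \<in> closed_parabolic_domain T. u_upper z \<le> u_lower z)) \<and>
     (\<forall>u v.
        cauchy_visc_solution T \<sigma> K F u0 u \<and>
        (\<exists>\<omega>0. modulus_of_continuity \<omega>0 \<and> attains_initial_with T u0 \<omega>0 u) \<and>
        cauchy_visc_solution T \<sigma> K F u0 v \<and>
        (\<exists>\<omega>0. modulus_of_continuity \<omega>0 \<and> attains_initial_with T u0 \<omega>0 v) \<longrightarrow>
        (\<forall>z \<in> closed_parabolic_domain T. u z = v z))"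
proof -
  obtain Kb where Kb: "\<And>z. \<bar>kbar z\<bar> \<le> Kb"
    using assms(7) by (auto simp: bounded_iff)
  have K_le: "K z \<le> Kb * norm z powr (- real DIM('a) - \<sigma>)" if "z \<noteq> 0" for z
  proof -
    have "norm z powr (real DIM('a) + \<sigma>) * norm z powr (- real DIM('a) - \<sigma>) = 1"
      using that by (subst powr_add[symmetric]) simp
    then have "K z = kbar z * norm z powr (- real DIM('a) - \<sigma>)"
      using assms(6)[OF that] by (simp add: mult.assoc)
    also have "\<dots> \<le> Kb * norm z powr (- real DIM('a) - \<sigma>)"
      using Kb[of z] by (intro mult_right_mono) auto
    finally show ?thesis .
  qed
  have comparison: "u z \<le> v z"
    if super: "visc_supersolution T \<sigma> K F v" and sub: "visc_subsolution T \<sigma> K F u"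
      and mod0: "modulus_of_continuity \<omega>0"
      and init: "attains_initial_with T u0 \<omega>0 v" "attains_initial_with T u0 \<omega>0 u"
      and z: "z \<in> closed_parabolic_domain T" for u v \<omega>0 z
  proof (rule ccontr)
    assume "\<not> u z \<le> v z"
    then have gap: "0 < u z - v z" by simp
    obtain x0 t0 where z0: "z = (x0, t0)" "t0 \<in> {0..T}"
      using z by (auto simp: closed_parabolic_domain_def)
    obtain M1 where M1: "\<And>z. z \<in> closed_parabolic_domain T \<Longrightarrow> \<bar>u z\<bar> \<le> M1"
      using sub by (auto simp: visc_subsolution_def bounded_iff)
    obtain M2 where M2: "\<And>z. z \<in> closed_parabolic_domain T \<Longrightarrow> \<bar>v z\<bar> \<le> M2"
      using super by (auto simp: visc_supersolution_def bounded_iff)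
    define M where "M = max M1 M2"
    have u_le: "\<bar>u (x, t)\<bar> \<le> M" and v_le: "\<bar>v (x, t)\<bar> \<le> M" if "t \<in> {0..T}" for x t
      using M1[of "(x, t)"] M2[of "(x, t)"] that by (auto simp: M_def closed_parabolic_domain_def)
    \<comment> \<open>Half of the gap is reserved for the term \<open>\<eta> * t0\<close>, which
      \<open>\<eta> = S / T\<close> keeps at most \<open>S\<close>.\<close>
    define S where "S = (u z - v z) / 2"
    define \<eta> where "\<eta> = S / T"
    have S: "0 < S" "0 < \<eta>" using gap assms(1) by (simp_all add: S_def \<eta>_def)
    have "\<eta> * t0 \<le> \<eta> * T" using S z0 by (intro mult_left_mono) auto
    then have S_le: "S \<le> u (x0, t0) - v (x0, t0) - \<eta> * t0"
      using assms(1) by (simp add: \<eta>_def S_def z0(1))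
    \<comment> \<open>Three errors of \<open>S / 8\<close> will add up in the initial layer: one at
      each of the two times and one from \<open>u0\<close>. Their sum stays below
      \<open>S / 2\<close>.\<close>
    obtain t1 where t1: "0 < t1" "\<And>t. 0 \<le> t \<Longrightarrow> t < t1 \<Longrightarrow> \<omega>0 t < S / 8"
      using modulus_of_continuity_small[OF mod0, of "S / 8"] S by auto
    obtain \<rho> where \<rho>: "0 < \<rho>" "\<And>x y. dist x y < \<rho> \<Longrightarrow> dist (u0 x) (u0 y) < S / 8"
    proof -
      have "\<exists>d>0. \<forall>x\<in>UNIV. \<forall>y\<in>UNIV. dist y x < d \<longrightarrow> dist (u0 y) (u0 x) < S / 8"
        using assms(21)[unfolded uniformly_continuous_on_def, rule_format, of "S / 8"] S by auto
      then show ?thesis using that by blast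
    qed
    \<comment> \<open>Halving \<open>t1\<close> leaves room for the other time: \<open>s < a\<close>
      and \<open>|\<tau> - s| < a\<close> give \<open>\<tau> < t1\<close>. The second inequality
      follows from \<open>2 * M < G * a^2\<close>, which dictates \<open>G\<close>.\<close>
    define a where "a = min T (t1 / 2)"
    define G where "G = (2 * M + 1) / a\<^sup>2"
    have a: "0 < a" "a \<le> T" "2 * a \<le> t1" using t1 assms(1) by (auto simp: a_def)
    have M: "0 \<le> M" using u_le[OF z0(2), of x0] by linarith
    have G: "0 < G" "2 * M < G * a\<^sup>2" using a M by (simp_all add: G_def)
    have Kb0: "0 \<le> Kb" using Kb[of 0] by linarith
    interpret coercive_subsolution \<sigma> K Kb T M G a c C m' F u
      by unfold_locales (fact assms Kb0 K_le sub u_le G a)+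
    show False
    proof (rule doubling_contradiction[OF super v_le assms(11) _ assms(13,14) S z0(2) S_le \<rho>(1)])
      show "0 \<le> m" using assms(12) by simp
      fix x y :: 'a and \<tau> s
      assume \<tau>: "\<tau> \<in> {0..T}" and s: "s \<in> {0..T}" "s < a" and xy: "norm (x - y) < \<rho>"
        and Gd: "G * (\<tau> - s)\<^sup>2 \<le> 2 * M"
      have "G * (\<tau> - s)\<^sup>2 < G * a\<^sup>2" using Gd G by linarith
      then have "\<bar>\<tau> - s\<bar> < a" using G a power2_less_imp_less[of "\<bar>\<tau> - s\<bar>" a] by simp
      then have "\<omega>0 \<tau> < S / 8" "\<omega>0 s < S / 8" using t1(2) \<tau> s a by auto
      moreover have "\<bar>u (x, \<tau>) - u0 x\<bar> \<le> \<omega>0 \<tau>" "\<bar>v (y, s) - u0 y\<bar> \<le> \<omega>0 s"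
        using init \<tau> s by (auto simp: attains_initial_with_def)
      moreover have "\<bar>u0 x - u0 y\<bar> < S / 8" using \<rho>(2)[of x y] xy by (simp add: dist_norm)
      ultimately show "u (x, \<tau>) - v (y, s) < S / 2" using S by linarith
    qed
  qed
  have unique: "u z = v z"
    if u: "cauchy_visc_solution T \<sigma> K F u0 u" "modulus_of_continuity \<omega>1" "attains_initial_with T u0 \<omega>1 u"
      and v: "cauchy_visc_solution T \<sigma> K F u0 v" "modulus_of_continuity \<omega>2" "attains_initial_with T u0 \<omega>2 v"
      and z: "z \<in> closed_parabolic_domain T" for u v \<omega>1 \<omega>2 z
  proof -
    \<comment> \<open>Comparison requires one modulus for both functions; the sum dominates
      each.\<close>
    have mod: "modulus_of_continuity (\<lambda>t. \<omega>1 t + \<omega>2 t)"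
      by (rule modulus_of_continuity_add) fact+
    have nn: "0 \<le> \<omega>1 t" "0 \<le> \<omega>2 t" if "t \<in> {0..T}" for t
      using u v that by (auto simp: modulus_of_continuity_def)
    have "attains_initial_with T u0 (\<lambda>t. \<omega>1 t + \<omega>2 t) u"
      "attains_initial_with T u0 (\<lambda>t. \<omega>1 t + \<omega>2 t) v"
      unfolding attains_initial_with_def
    proof (safe)
      fix t x assume t: "t \<in> {0..T}"
      show "\<bar>u (x, t) - u0 x\<bar> \<le> \<omega>1 t + \<omega>2 t" "\<bar>v (x, t) - u0 x\<bar> \<le> \<omega>1 t + \<omega>2 t"
        using u(3)[unfolded attains_initial_with_def, rule_format, OF t, of x]
          v(3)[unfolded attains_initial_with_def, rule_format, OF t, of x] nn[OF t] by linarith+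
    qed
    moreover have "visc_subsolution T \<sigma> K F u" "visc_supersolution T \<sigma> K F u"
      "visc_subsolution T \<sigma> K F v" "visc_supersolution T \<sigma> K F v"
      using u(1) v(1) by (simp_all add: cauchy_visc_solution_def visc_solution_def)
    ultimately have "u z \<le> v z" "v z \<le> u z"
      using z by (auto intro!: comparison[OF _ _ mod])
    then show ?thesis by (rule order_antisym)
  qed
  show ?thesis
    by (intro conjI allI impI ballI; elim conjE exE; (rule comparison unique; assumption))
qed

end
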